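(* Let $\mathbb{T}^1=\mathbb{R}/\mathbb{Z}$ be the flat circle, let $c\in\mathbb{R}$, and let $U:\mathbb{T}^1\to\mathbb{R}$ be of class $C^3$ with a unique maximum point $x_0$, where $U(x_0)=c$ and $U''(x_0)<0$. Then, for all $\lambda>0$ small enough (i.e. there exists $\lambda_0>0$ such that for every $0<\lambda<\lambda_0$), the equation $$-\lambda u+\frac12|d_xu|^2+U(x)=c,\quad x\in\mathbb{T}^1,$$ has a unique viscosity solution.
   Context: Viscosity solutions are always assumed continuous. *)

theory Defs
  imports "HOL-Analysis.Analysis"
begin

definition int_cong :: "real \<Rightarrow> real \<Rightarrow> bool" where
  "int_cong s t \<longleftrightarrow> s - t \<in> \<int>"

quotient_type circle = real / int_cong
  morphisms rep_circle proj
proof (rule equivpI)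
  show "reflp int_cong" by (simp add: reflp_def int_cong_def)
  show "symp int_cong"
    by (metis Ints_minus int_cong_def minus_diff_eq sympI)
  show "transp int_cong"
  proof (rule transpI)
    fix r s t assume "int_cong r s" "int_cong s t"
    then have "(r - s) + (s - t) \<in> \<int>" unfolding int_cong_def by (rule Ints_add)
    then show "int_cong r t" by (simp add: int_cong_def)
  qed
qed

text \<open>The quotient topology.\<close>

instantiation circle :: topological_space
begin

definition open_circle :: "circle set \<Rightarrow> bool" where
  "open_circle S \<longleftrightarrow> open (proj -` S)"

instance
  by standard (auto simp: open_circle_def vimage_Union)

end

text \<open>The quotient map is a local diffeomorphism (a local isometry for the flat metric), so
  derivatives on the circle are those of the 1-periodic lift. The chosen representative is
  irrelevant, see \<open>circle_deriv_proj\<close> below. As for \<^const>\<open>deriv\<close>, the value is only meaningful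
  where the lift is differentiable.\<close>

definition circle_deriv :: "(circle \<Rightarrow> real) \<Rightarrow> circle \<Rightarrow> real" where
  "circle_deriv f x = deriv (\<lambda>t. f (proj t)) (rep_circle x)"

lemma circle_deriv_proj: "circle_deriv f (proj t) = deriv (\<lambda>s. f (proj s)) t"
proof -
  let ?g = "\<lambda>s. f (proj s)" and ?r = "rep_circle (proj t)"
  have per: "?g (s + (?r - t)) = ?g s" for s
  proof -
    have "int_cong ?r t"
      using Quotient3_rep_abs[OF Quotient3_circle] Quotient3_rel_rep[OF Quotient3_circle]
        Quotient3_abs_rep[OF Quotient3_circle]
      by (metis circle.abs_eq_iff)
    then have "int_cong (s + (?r - t)) s" by (simp add: int_cong_def)
    then show ?thesis by (metis circle.abs_eq_iff)
  qed
  have "(?g has_field_derivative D) (at ?r) \<longleftrightarrow> (?g has_field_derivative D) (at t)" for D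
    using DERIV_shift[of ?g D t "?r - t"] per by simp
  then show ?thesis by (simp add: circle_deriv_def deriv_def)
qed

definition circle_C :: "nat \<Rightarrow> (circle \<Rightarrow> real) \<Rightarrow> bool" where
  "circle_C k f \<longleftrightarrow>
    (\<forall>i<k. \<forall>t. (\<lambda>s. (circle_deriv ^^ i) f (proj s)) field_differentiable (at t)) \<and>
    continuous_on UNIV ((circle_deriv ^^ k) f)"

text \<open>Viscosity solutions of \<open>F(x, u(x), d\<^sub>xu) = c\<close> on the circle, with \<open>C\<^sup>1\<close> test functions
  touching \<open>u\<close> locally. No monotonicity of \<open>F\<close> in \<open>u\<close> is assumed, so the sign of \<open>F\<close> matters:
  the solutions for \<open>F = c\<close> and for \<open>- F = - c\<close> differ in general.\<close>

definition viscosity_subsolution ::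
    "(circle \<Rightarrow> real \<Rightarrow> real \<Rightarrow> real) \<Rightarrow> real \<Rightarrow> (circle \<Rightarrow> real) \<Rightarrow> bool" where
  "viscosity_subsolution F c u \<longleftrightarrow> continuous_on UNIV u \<and>
    (\<forall>\<phi> x. circle_C 1 \<phi> \<and> (\<forall>\<^sub>F y in nhds x. u y - \<phi> y \<le> u x - \<phi> x) \<longrightarrow>
      F x (u x) (circle_deriv \<phi> x) \<le> c)"

definition viscosity_supersolution ::
    "(circle \<Rightarrow> real \<Rightarrow> real \<Rightarrow> real) \<Rightarrow> real \<Rightarrow> (circle \<Rightarrow> real) \<Rightarrow> bool" where
  "viscosity_supersolution F c u \<longleftrightarrow> continuous_on UNIV u \<and>
    (\<forall>\<phi> x. circle_C 1 \<phi> \<and> (\<forall>\<^sub>F y in nhds x. u y - \<phi> y \<ge> u x - \<phi> x) \<longrightarrow>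
      F x (u x) (circle_deriv \<phi> x) \<ge> c)"

definition viscosity_solution ::
    "(circle \<Rightarrow> real \<Rightarrow> real \<Rightarrow> real) \<Rightarrow> real \<Rightarrow> (circle \<Rightarrow> real) \<Rightarrow> bool" where
  "viscosity_solution F c u \<longleftrightarrow>
    viscosity_subsolution F c u \<and> viscosity_supersolution F c u"

end

theory Submission
  imports Defs
begin

text \<open>Lift everything to \<open>\<real>\<close> with \<open>x0\<close> at the integers and put \<open>V = c - U\<close>, a nonnegative
  1-periodic potential that vanishes exactly at the integers, nondegenerately. The equation becomes
  \<open>u'\<^sup>2 / 2 = E\<close> with energy \<open>E = V + \<lambda> u\<close>. Since \<open>u'\<^sup>2 / 2 - V - \<lambda> u\<close> decreases in \<open>u\<close>,
  there is no comparison principle; uniqueness comes from the shape that the potential forces on a solution.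

  The subsolution property gives \<open>E \<ge> 0\<close> and \<open>\<bar>u'\<bar> \<le> sqrt (2 E)\<close> (\<open>energy_nonneg\<close>, \<open>slope_bound\<close>),
  the supersolution property gives \<open>E = 0\<close> at every local minimum. There \<open>u\<close> is flat, because
  the slope bound tends to 0, and \<open>V + \<lambda> u \<ge> 0\<close> attains its minimum, so \<open>V' = 0\<close>
  (\<open>critical_at_local_min\<close>). Solutions have a Lipschitz constant \<open>L\<close> independent of \<open>\<lambda> \<le> 1\<close>
  (\<open>periodic_slope_bound\<close>), hence \<open>V \<le> \<lambda> L\<close> at a local minimum. For small \<open>\<lambda>\<close> this leaves
  only the integers: near the nondegenerate minimum of \<open>V\<close> there is no other critical point, and
  away from it \<open>V\<close> is bounded below. So on \<open>[0, 1]\<close> a solution starts from 0, increases to a single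
  maximum and decreases back to 0 (\<open>solution_shape\<close>).

  On the increasing part \<open>u' = sqrt (2 (V + \<lambda> u))\<close>. The right side is not Lipschitz in \<open>u\<close> at the
  starting point, but there \<open>2 V \<ge> \<kappa>\<^sup>2 t\<^sup>2\<close> for some \<open>\<kappa> > 0\<close>, so two solutions satisfy
  \<open>\<bar>(u - v)'\<bar> \<le> (\<lambda> / (\<kappa> t)) \<bar>u - v\<bar>\<close> near 0. A nonzero difference would then decay towards 0 no
  faster than \<open>t\<close> to the power \<open>\<lambda> / \<kappa>\<close>, whereas the Lipschitz bound makes it \<open>O(t)\<close>
  (\<open>increasing_branch_unique\<close>). The decreasing part is the reflection of an increasing one, and two
  solutions that share both branches agree in between as well (\<open>solution_unique\<close>).

  For existence, Picard iteration from 0 is monotone and converges to an increasing branch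
  (\<open>increasing_branch_exists\<close>); the minimum of an increasing branch from 0 and a decreasing branch
  into 1 has only a concave kink, which viscosity solutions of a convex equation may have
  (\<open>solution_exists\<close>).\<close>

section \<open>Slopes of solutions in terms of the energy\<close>

text \<open>The slopes of parabolas that touch from above. Only parabolas are needed to extract
  information from a viscosity solution, and a parabola is easily dominated by a smooth periodic
  function, which is what the test functions on the circle have to be.\<close>

definition superjet :: "(real \<Rightarrow> real) \<Rightarrow> real \<Rightarrow> real \<Rightarrow> bool" where
  "superjet u t p \<longleftrightarrow> (\<exists>B. \<forall>\<^sub>F s in nhds t. u s \<le> u t + p * (s - t) + B * (s - t)\<^sup>2)"

text \<open>The parabola version of a viscosity solution of \<open>- lam u + u'\<^sup>2 / 2 - V = 0\<close> on the line. In the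
  second clause the slope of the parabola that touches \<open>u\<close> from below is \<open>- p\<close>, which the square
  does not notice.\<close>

definition jet_solution :: "real \<Rightarrow> (real \<Rightarrow> real) \<Rightarrow> (real \<Rightarrow> real) \<Rightarrow> bool" where
  "jet_solution lam V u \<longleftrightarrow> continuous_on UNIV V \<and> continuous_on UNIV u \<and>
    (\<forall>t p. superjet u t p \<longrightarrow> p\<^sup>2 / 2 \<le> V t + lam * u t) \<and>
    (\<forall>t p. superjet (\<lambda>s. - u s) t p \<longrightarrow> V t + lam * u t \<le> p\<^sup>2 / 2)"

lemma jet_solutionD:
  assumes "jet_solution lam V u"
  shows "continuous_on A V" "continuous_on A u" "continuous_on A (\<lambda>t. V t + lam * u t)"
    "superjet u t p \<Longrightarrow> p\<^sup>2 / 2 \<le> V t + lam * u t"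
    "superjet (\<lambda>s. - u s) t p \<Longrightarrow> V t + lam * u t \<le> p\<^sup>2 / 2"
proof -
  show c: "continuous_on A V" "continuous_on A u"
    using assms continuous_on_subset unfolding jet_solution_def by blast+
  show "continuous_on A (\<lambda>t. V t + lam * u t)" by (intro continuous_intros c)
qed (use assms in \<open>auto simp: jet_solution_def\<close>)

lemma continuous_less_nhds:
  fixes f :: "real \<Rightarrow> real"
  assumes "continuous_on UNIV f" "f t < c"
  obtains d where "d > 0" "\<And>s. dist s t < d \<Longrightarrow> f s < c"
proof -
  have "f \<midarrow>t\<rightarrow> f t" using assms(1) by (simp add: continuous_on_eq_continuous_at isCont_def)
  then have "(f \<longlongrightarrow> f t) (nhds t)" by (simp add: tendsto_nhds_iff)
  then have "\<forall>\<^sub>F s in nhds t. f s < c" by (rule order_tendstoD(2)[OF _ assms(2)])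
  then show ?thesis using that unfolding eventually_nhds_metric by blast
qed

lemma superjet_reflect:
  assumes "superjet (\<lambda>s. u (1 - s)) t p"
  shows "superjet u (1 - t) (- p)"
proof -
  obtain B where "\<forall>\<^sub>F s in nhds t. u (1 - s) \<le> u (1 - t) + p * (s - t) + B * (s - t)\<^sup>2"
    using assms unfolding superjet_def by blast
  then obtain d where d: "d > 0"
    "\<And>s. dist s t < d \<Longrightarrow> u (1 - s) \<le> u (1 - t) + p * (s - t) + B * (s - t)\<^sup>2"
    unfolding eventually_nhds_metric by blast
  have "u s \<le> u (1 - t) + - p * (s - (1 - t)) + B * (s - (1 - t))\<^sup>2"
    if "dist s (1 - t) < d" for s
  proof -
    have "dist (1 - s) t < d" using that by (simp add: dist_real_def)
    from d(2)[OF this] show ?thesis by (simp add: algebra_simps power2_eq_square)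
  qed
  with d(1) show ?thesis unfolding superjet_def eventually_nhds_metric by blast
qed

lemma jet_solution_reflect:
  assumes "jet_solution lam V u"
  shows "jet_solution lam (\<lambda>t. V (1 - t)) (\<lambda>t. u (1 - t))"
proof -
  have 1: "continuous_on UNIV (\<lambda>t. h (1 - t))" if "continuous_on UNIV h" for h :: "real \<Rightarrow> real"
    by (rule continuous_on_compose2[OF that]) (auto intro!: continuous_intros)
  show ?thesis
    using assms 1 superjet_reflect[of u] superjet_reflect[of "\<lambda>s. - u s"]
    unfolding jet_solution_def by (metis power2_minus)
qed

text \<open>A mean value theorem for touching parabolas. The penalty \<open>C (max 0 (x - b))\<^sup>2\<close> moves the maximum
  of \<open>u x - K x\<close> over \<open>[a, b']\<close> into the interior; its derivative is nonnegative, so the touching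
  slope is still at least \<open>K\<close>, and its second derivative is at most \<open>2 C\<close>, so the penalty lies below a
  parabola that touches it.\<close>

lemma superjet_of_slope:
  fixes u :: "real \<Rightarrow> real"
  assumes u: "continuous_on {a..b'} u" and ab: "a < b" "b < b'" and K: "u b - u a > K * (b - a)"
  obtains z p where "a < z" "z < b'" "p \<ge> K" "superjet u z p"
proof -
  define C where "C = (\<bar>u b' - u a - K * (b' - a)\<bar> + 1) / (b' - b)\<^sup>2"
  have C: "C \<ge> 0" "C * (b' - b)\<^sup>2 > u b' - u a - K * (b' - a)"
    using ab by (auto simp: C_def)
  define h where "h = (\<lambda>x. u x - K * x - C * (max 0 (x - b))\<^sup>2)"
  have "continuous_on {a..b'} h" unfolding h_def by (intro continuous_intros u)
  then obtain z where z: "z \<in> {a..b'}" and zmax: "\<And>x. x \<in> {a..b'} \<Longrightarrow> h x \<le> h z"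
    using continuous_attains_sup[of "{a..b'}" h] ab by auto
  have ha: "h a < h b" using ab K by (simp add: h_def algebra_simps)
  have hb: "h b' < h a" using ab C(2) by (simp add: h_def algebra_simps)
  have "z \<noteq> a" "z \<noteq> b'" using zmax[of b] ha hb ab by auto
  then have zz: "a < z" "z < b'" using z by auto
  define p where "p = K + 2 * C * max 0 (z - b)"
  have "p \<ge> K" using C by (simp add: p_def)
  have "\<forall>\<^sub>F s in nhds z. s \<in> {a<..<b'}" by (rule eventually_nhds_in_open) (use zz in auto)
  then have "\<forall>\<^sub>F s in nhds z. u s \<le> u z + p * (s - z) + C * (s - z)\<^sup>2"
  proof eventually_elim
    case (elim s)
    have "(max 0 (s - b))\<^sup>2 \<le> (max 0 (z - b))\<^sup>2 + 2 * max 0 (z - b) * (s - z) + (s - z)\<^sup>2"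
    proof -
      consider (both) "s \<le> b" "z \<le> b" | (right) "s \<le> b" "z > b" | (left) "s > b" "z \<le> b" | "s > b" "z > b" by linarith
      then show ?thesis
      proof cases
        case both
        then show ?thesis by simp
      next
        case right
        have "0 \<le> ((z - b) + (s - z))\<^sup>2" by simp
        also have "\<dots> = (z - b)\<^sup>2 + 2 * (z - b) * (s - z) + (s - z)\<^sup>2" by (rule power2_sum[THEN trans]) simp
        finally show ?thesis using right by simp
      next
        case left
        then have "(s - b)\<^sup>2 \<le> (s - z)\<^sup>2" by (intro power_mono) auto
        then show ?thesis using left by simp
      qed (auto simp: power2_eq_square algebra_simps)
    qed
    then have "C * (max 0 (s - b))\<^sup>2 \<le> C * ((max 0 (z - b))\<^sup>2 + 2 * max 0 (z - b) * (s - z) + (s - z)\<^sup>2)"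
      using C(1) by (rule mult_left_mono)
    moreover have "h s \<le> h z" using zmax[of s] elim by auto
    ultimately show ?case unfolding h_def p_def by (simp add: algebra_simps)
  qed
  then have "superjet u z p" unfolding superjet_def by blast
  with that zz \<open>p \<ge> K\<close> show ?thesis by blast
qed

text \<open>Some parabola touches a continuous function from above in every interval, so \<open>V + lam u\<close> is
  nonnegative on a dense set.\<close>

lemma energy_nonneg:
  assumes sol: "jet_solution lam V u"
  shows "V t + lam * u t \<ge> 0"
proof (rule ccontr)
  assume neg: "\<not> ?thesis"
  then have "V t + lam * u t < 0" by simp
  then obtain d where d: "d > 0" "\<And>s. dist s t < d \<Longrightarrow> V s + lam * u s < 0"
    using continuous_less_nhds[OF jet_solutionD(3)[OF sol]] by blast
  define K where "K = (u t - u (t - d/2)) / (d/2) - 1"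
  have "u t - u (t - d/2) > K * (t - (t - d/2))" using d(1) by (simp add: K_def field_simps)
  moreover have "t - d/2 < t" "t < t + d/2" using d(1) by auto
  ultimately obtain z p where "t - d/2 < z" "z < t + d/2" "superjet u z p"
    using superjet_of_slope[OF jet_solutionD(2)[OF sol], of "t - d/2" t "t + d/2" K] by blast
  then have "p\<^sup>2 / 2 \<le> V z + lam * u z" "V z + lam * u z < 0"
    using jet_solutionD(4)[OF sol] d by (auto simp: dist_real_def)
  then show False by (smt (verit) zero_le_power2 divide_nonneg_pos)
qed

lemma slope_le:
  assumes sol: "jet_solution lam V u" and ab: "a < b" and K: "K \<ge> 0"
    and E: "\<And>s. s \<in> {a..b} \<Longrightarrow> V s + lam * u s \<le> K\<^sup>2 / 2"
  shows "u b - u a \<le> K * (b - a)"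
proof (rule ccontr)
  assume "\<not> ?thesis"
  then have "K < (u b - u a) / (b - a)" using ab by (simp add: field_simps)
  then obtain K' where K': "K < K'" "K' < (u b - u a) / (b - a)" using dense by blast
  have lt: "K\<^sup>2 / 2 < K'\<^sup>2 / 2" using K' K by (simp add: power_strict_mono)
  have "V b + lam * u b < K'\<^sup>2 / 2" using E[of b] lt ab by auto
  then obtain d where d: "d > 0" "\<And>s. dist s b < d \<Longrightarrow> V s + lam * u s < K'\<^sup>2 / 2"
    using continuous_less_nhds[OF jet_solutionD(3)[OF sol]] by blast
  obtain z p where z: "a < z" "z < b + d" "p \<ge> K'" "superjet u z p"
  proof -
    have "u b - u a > K' * (b - a)" using K' ab by (simp add: field_simps)
    moreover have "b < b + d" using d(1) by simp
    ultimately show ?thesis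
      using superjet_of_slope[OF jet_solutionD(2)[OF sol] ab, of "b + d" K'] that by blast
  qed
  have "V z + lam * u z < K'\<^sup>2 / 2"
  proof (cases "z \<le> b")
    case True then show ?thesis using E[of z] lt z by auto
  next
    case False then show ?thesis using d(2)[of z] z by (auto simp: dist_real_def)
  qed
  moreover have "p\<^sup>2 / 2 \<le> V z + lam * u z" using jet_solutionD(4)[OF sol] z by blast
  moreover have "K'\<^sup>2 \<le> p\<^sup>2" using z K K' by (intro power_mono) auto
  ultimately show False by simp
qed

lemma slope_bound:
  assumes sol: "jet_solution lam V u" and ab: "a \<le> b" and K: "K \<ge> 0"
    and E: "\<And>s. s \<in> {a..b} \<Longrightarrow> V s + lam * u s \<le> K\<^sup>2 / 2"
  shows "\<bar>u b - u a\<bar> \<le> K * (b - a)"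
proof (cases "a = b")
  case False
  have "u (1 - (1 - a)) - u (1 - (1 - b)) \<le> K * ((1 - a) - (1 - b))"
    by (rule slope_le[OF jet_solution_reflect[OF sol] _ K]) (use ab False E in auto)
  moreover have "u b - u a \<le> K * (b - a)"
    by (rule slope_le[OF sol _ K]) (use ab False E in auto)
  ultimately show ?thesis by (auto simp: abs_le_iff algebra_simps)
qed auto

text \<open>A chord that is too flat gives a touching parabola from below of slope \<open>q < K\<close>. The supersolution
  property then forces \<open>q \<le> - K\<close>, which monotonicity excludes.\<close>

lemma slope_ge_if_mono:
  assumes sol: "jet_solution lam V u" and ab: "a < b"
    and mono: "mono_on {a..b} u"
    and E: "\<And>s. s \<in> {a..b} \<Longrightarrow> K\<^sup>2 / 2 \<le> V s + lam * u s"
  shows "K * (b - a) \<le> u b - u a"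
proof (rule ccontr)
  assume "\<not> ?thesis"
  then have "(u b - u a) / (b - a) < K" using ab by (simp add: field_simps)
  then obtain K' where K': "K' < K" "(u b - u a) / (b - a) < K'" using dense by blast
  have "0 \<le> (u b - u a) / (b - a)" using mono_onD[OF mono, of a b] ab by auto
  then have K'0: "0 < K'" using K' by linarith
  have "u b - u a - K' * (b - a) < 0" using K' ab by (simp add: field_simps)
  moreover have "continuous_on UNIV (\<lambda>s. u s - u a - K' * (s - a))"
    by (intro continuous_intros jet_solutionD(2)[OF sol])
  ultimately obtain d where d: "d > 0" "\<And>s. dist s b < d \<Longrightarrow> u s - u a - K' * (s - a) < 0"
    using continuous_less_nhds[of "\<lambda>s. u s - u a - K' * (s - a)" b 0] by blast
  define b0 where "b0 = max ((a + b) / 2) (b - d/2)"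
  have b0: "a < b0" "b0 < b" "dist b0 b < d" using ab d(1) by (auto simp: b0_def dist_real_def less_max_iff_disj)
  have "- u b0 - - u a > - K' * (b0 - a)" using d(2)[OF b0(3)] by simp
  moreover have "continuous_on {a..b} (\<lambda>s. - u s)"
    by (intro continuous_intros jet_solutionD(2)[OF sol])
  ultimately obtain z p where z: "a < z" "z < b" "p \<ge> - K'" "superjet (\<lambda>s. - u s) z p"
    using superjet_of_slope[of a b "\<lambda>s. - u s" b0 "- K'"] b0 by blast
  have "V z + lam * u z \<le> p\<^sup>2 / 2" using jet_solutionD(5)[OF sol z(4)] .
  then have "K\<^sup>2 \<le> p\<^sup>2" using E[of z] z by auto
  then have "\<bar>K\<bar> \<le> \<bar>p\<bar>" by (simp add: abs_le_square_iff)
  then have p: "p > 0" using z(3) K' K'0 by linarith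
  \<comment> \<open>a nondecreasing function cannot be touched from below with the negative slope \<open>- p\<close>\<close>
  obtain B where B: "\<forall>\<^sub>F s in nhds z. - u s \<le> - u z + p * (s - z) + B * (s - z)\<^sup>2"
    using z(4) unfolding superjet_def by blast
  then obtain e where e: "e > 0" "\<And>s. dist s z < e \<Longrightarrow> - u s \<le> - u z + p * (s - z) + B * (s - z)\<^sup>2"
    unfolding eventually_nhds_metric by blast
  define h where "h = min (min (e/2) (z - a)) (p / (2 * (\<bar>B\<bar> + 1)))"
  have h: "h > 0" "h \<le> z - a" "h < e" "h \<le> p / (2 * (\<bar>B\<bar> + 1))"
    using e(1) z p by (auto simp: h_def)
  have "u (z - h) \<le> u z" using mono_onD[OF mono, of "z - h" z] h z by auto
  then have "0 \<le> - p * h + B * h\<^sup>2" using e(2)[of "z - h"] h by (auto simp: dist_real_def)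
  then have "p * h \<le> (B * h) * h" by (simp add: power2_eq_square)
  then have "p \<le> B * h" using h(1) by simp
  moreover have "B * h \<le> (\<bar>B\<bar> + 1) * h" using h(1) by (intro mult_right_mono) auto
  moreover have "(\<bar>B\<bar> + 1) * h \<le> (\<bar>B\<bar> + 1) * (p / (2 * (\<bar>B\<bar> + 1)))"
    using h(4) by (intro mult_left_mono) auto
  moreover have "(\<bar>B\<bar> + 1) * (p / (2 * (\<bar>B\<bar> + 1))) = p / 2" by (simp add: field_simps)
  ultimately show False using p by linarith
qed

lemma derivI_slopes:
  fixes f :: "real \<Rightarrow> real"
  assumes "\<And>e. e > 0 \<Longrightarrow> \<exists>d>0. \<forall>a b. a < b \<and> t - d < a \<and> b < t + d \<longrightarrow>
    \<bar>f b - f a - D * (b - a)\<bar> \<le> e * (b - a)"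
  shows "(f has_real_derivative D) (at t)"
  unfolding has_field_derivative_def has_derivative_within_alt
proof (intro conjI allI impI)
  show "bounded_linear ((*) D)" by (rule bounded_linear_mult_right)
  fix e :: real assume "e > 0"
  from assms[OF this] obtain d where d: "d > 0" "\<And>a b. a < b \<Longrightarrow> t - d < a \<Longrightarrow> b < t + d \<Longrightarrow>
    \<bar>f b - f a - D * (b - a)\<bar> \<le> e * (b - a)" by (elim exE conjE) metis
  have "norm (f y - f t - D * (y - t)) \<le> e * norm (y - t)" if "norm (y - t) < d" for y
    using d(2)[of y t] d(2)[of t y] that d(1)
    by (cases y t rule: linorder_cases) (auto simp: abs_le_iff algebra_simps)
  then show "\<exists>d>0. \<forall>y\<in>UNIV. norm (y - t) < d \<longrightarrow> norm (f y - f t - D * (y - t)) \<le> e * norm (y - t)"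
    using d(1) by blast
qed

text \<open>The bounds on chords turn continuity of this square root into differentiability of \<open>u\<close>.\<close>

lemma energy_near:
  assumes sol: "jet_solution lam V u" and "e > 0"
  obtains d where "d > 0"
    "\<And>s. \<bar>s - t\<bar> < d \<Longrightarrow> \<bar>sqrt (2 * (V s + lam * u s)) - sqrt (2 * (V t + lam * u t))\<bar> < e"
proof -
  have "continuous_on UNIV (\<lambda>s. sqrt (2 * (V s + lam * u s)))"
    by (intro continuous_intros jet_solutionD(1,2)[OF sol])
  then have "isCont (\<lambda>s. sqrt (2 * (V s + lam * u s))) t"
    by (simp add: continuous_on_eq_continuous_at)
  then show ?thesis using that \<open>e > 0\<close> unfolding continuous_at_eps_delta dist_real_def by blast
qed

lemma sqrt_energy:
  assumes sol: "jet_solution lam V u"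
  shows "(sqrt (2 * (V s + lam * u s)))\<^sup>2 / 2 = V s + lam * u s" "sqrt (2 * (V s + lam * u s)) \<ge> 0"
  using energy_nonneg[OF sol, of s] by auto

lemma deriv_zero_energy:
  assumes sol: "jet_solution lam V u" and t: "V t + lam * u t = 0"
  shows "(u has_real_derivative 0) (at t)"
proof (rule derivI_slopes)
  fix e :: real assume "e > 0"
  then obtain d where d: "d > 0"
    "\<And>s. \<bar>s - t\<bar> < d \<Longrightarrow> \<bar>sqrt (2 * (V s + lam * u s)) - sqrt (2 * (V t + lam * u t))\<bar> < e"
    using energy_near[OF sol] by blast
  have "\<bar>u b - u a - 0 * (b - a)\<bar> \<le> e * (b - a)" if "a < b" "t - d < a" "b < t + d" for a b
  proof -
    have "V s + lam * u s \<le> e\<^sup>2 / 2" if "s \<in> {a..b}" for s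
    proof -
      have "\<bar>s - t\<bar> < d" using that \<open>t - d < a\<close> \<open>b < t + d\<close> by auto
      from d(2)[OF this] have "sqrt (2 * (V s + lam * u s)) \<le> e" unfolding t by simp
      then have "(sqrt (2 * (V s + lam * u s)))\<^sup>2 \<le> e\<^sup>2"
        using sqrt_energy(2)[OF sol] by (intro power_mono) auto
      then show ?thesis using sqrt_energy(1)[OF sol, of s] by linarith
    qed
    then have "\<bar>u b - u a\<bar> \<le> e * (b - a)" using slope_bound[OF sol, of a b e] that \<open>e > 0\<close> by auto
    then show ?thesis by simp
  qed
  then show "\<exists>d>0. \<forall>a b. a < b \<and> t - d < a \<and> b < t + d \<longrightarrow> \<bar>u b - u a - 0 * (b - a)\<bar> \<le> e * (b - a)"
    using d(1) by blast
qed

lemma deriv_if_mono: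
  assumes sol: "jet_solution lam V u" and mono: "mono_on {x..y} u" and t: "x < t" "t < y"
  shows "(u has_real_derivative sqrt (2 * (V t + lam * u t))) (at t)"
proof (rule derivI_slopes)
  fix e :: real assume e: "e > 0"
  let ?G = "\<lambda>s. sqrt (2 * (V s + lam * u s))"
  obtain d0 where d0: "d0 > 0" "\<And>s. \<bar>s - t\<bar> < d0 \<Longrightarrow> \<bar>?G s - ?G t\<bar> < e"
    using energy_near[OF sol e] by blast
  define d where "d = min d0 (min (t - x) (y - t))"
  have "\<bar>u b - u a - ?G t * (b - a)\<bar> \<le> e * (b - a)" if ab: "a < b" "t - d < a" "b < t + d" for a b
  proof -
    have G: "\<bar>?G s - ?G t\<bar> < e" if "s \<in> {a..b}" for s
      using d0(2)[of s] that ab by (auto simp: d_def)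
    have mono': "mono_on {a..b} u" by (rule mono_on_subset[OF mono]) (use ab in \<open>auto simp: d_def\<close>)
    have "\<bar>u b - u a\<bar> \<le> (?G t + e) * (b - a)"
    proof (rule slope_bound[OF sol])
      show "0 \<le> ?G t + e" using e sqrt_energy(2)[OF sol, of t] by linarith
      fix s assume "s \<in> {a..b}"
      then have "(?G s)\<^sup>2 \<le> (?G t + e)\<^sup>2" using G[of s] sqrt_energy(2)[OF sol, of s] by (intro power_mono) auto
      then show "V s + lam * u s \<le> (?G t + e)\<^sup>2 / 2" using sqrt_energy(1)[OF sol, of s] by linarith
    qed (use ab in auto)
    moreover have "max 0 (?G t - e) * (b - a) \<le> u b - u a"
    proof (rule slope_ge_if_mono[OF sol ab(1) mono'])
      fix s assume "s \<in> {a..b}"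
      then have "(max 0 (?G t - e))\<^sup>2 \<le> (?G s)\<^sup>2" using G[of s] sqrt_energy(2)[OF sol, of s] by (intro power_mono) auto
      then show "(max 0 (?G t - e))\<^sup>2 / 2 \<le> V s + lam * u s" using sqrt_energy(1)[OF sol, of s] by linarith
    qed
    moreover have "(?G t - e) * (b - a) \<le> max 0 (?G t - e) * (b - a)"
      using ab by (intro mult_right_mono) auto
    ultimately show ?thesis by (auto simp: abs_le_iff algebra_simps)
  qed
  moreover have "d > 0" using d0 t by (auto simp: d_def)
  ultimately show "\<exists>d>0. \<forall>a b. a < b \<and> t - d < a \<and> b < t + d \<longrightarrow> \<bar>u b - u a - ?G t * (b - a)\<bar> \<le> e * (b - a)"
    by blast
qed

section \<open>Local minima and a Lipschitz bound\<close>

lemma energy_zero_at_local_min: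
  assumes sol: "jet_solution lam V u" and min: "\<forall>\<^sub>F s in nhds y. u y \<le> u s"
  shows "V y + lam * u y = 0"
proof -
  have "superjet (\<lambda>s. - u s) y 0"
    unfolding superjet_def by (rule exI[of _ 0]) (use min in simp)
  then show ?thesis using jet_solutionD(5)[OF sol] energy_nonneg[OF sol, of y] by fastforce
qed

text \<open>At a local minimum the nonnegative function \<open>V + lam u\<close> vanishes, so its derivative does, while
  \<open>u' = 0\<close> by \<open>deriv_zero_energy\<close>.\<close>

lemma critical_at_local_min:
  assumes sol: "jet_solution lam V u" and min: "\<forall>\<^sub>F s in nhds y. u y \<le> u s"
    and D: "(V has_real_derivative D) (at y)"
  shows "D = 0"
proof -
  have E: "V y + lam * u y = 0" by (rule energy_zero_at_local_min[OF sol min])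
  have "((\<lambda>s. V s + lam * u s) has_real_derivative D + lam * 0) (at y)"
    by (intro DERIV_add DERIV_cmult D deriv_zero_energy[OF sol E])
  moreover have "\<forall>s. \<bar>y - s\<bar> < 1 \<longrightarrow> V y + lam * u y \<le> V s + lam * u s"
    using energy_nonneg[OF sol] E by auto
  ultimately show ?thesis using DERIV_local_min[of _ "D + lam * 0" y 1] by simp
qed

lemma mono_on_if_no_local_min:
  fixes u :: "real \<Rightarrow> real"
  assumes u: "continuous_on {a..b} u"
    and no: "\<And>y. a < y \<Longrightarrow> y < b \<Longrightarrow> \<not> (\<forall>\<^sub>F s in nhds y. u y \<le> u s)"
    and max: "\<And>t. t \<in> {a..b} \<Longrightarrow> u t \<le> u b"
  shows "mono_on {a..b} u"
proof (rule mono_onI, rule ccontr)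
  fix s t assume st: "s \<in> {a..b}" "t \<in> {a..b}" "s \<le> t" "\<not> u s \<le> u t"
  have "continuous_on {s..b} u" by (rule continuous_on_subset[OF u]) (use st in auto)
  then obtain z where z: "z \<in> {s..b}" "\<And>x. x \<in> {s..b} \<Longrightarrow> u z \<le> u x"
    using continuous_attains_inf[of "{s..b}" u] st by auto
  have "u z < u s" using z(2)[of t] st by auto
  moreover have "u s \<le> u b" using max st by auto
  ultimately have sz: "s < z" "z < b" using z(1) by (auto simp: less_le)
  then have "\<forall>\<^sub>F x in nhds z. x \<in> {s<..<b}" by (intro eventually_nhds_in_open) auto
  then have "\<forall>\<^sub>F x in nhds z. u z \<le> u x" by eventually_elim (use z in auto)
  then show False using no[of z] sz st by auto
qed

lemma periodic_frac:
  fixes u :: "real \<Rightarrow> real"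
  assumes "\<And>t n. u (t + of_int n) = u t"
  shows "u t = u (frac t)"
  using assms[of "frac t" "\<lfloor>t\<rfloor>"] by (simp add: frac_def)

text \<open>The minimum of \<open>u\<close> is nonpositive since the energy vanishes there, so the maximum \<open>M\<close> is at most
  the oscillation over a period: \<open>M \<le> sqrt (2 (C + lam M))\<close>. With \<open>lam \<le> 1\<close> this bounds \<open>M\<close> by
  \<open>2 + 2 C\<close>, and the constant does not depend on \<open>lam\<close>.\<close>

lemma periodic_slope_bound:
  assumes sol: "jet_solution lam V u" and per: "\<And>t n. u (t + of_int n) = u t"
    and lam: "0 < lam" "lam \<le> 1" and V: "\<And>t. 0 \<le> V t" "\<And>t. V t \<le> C"
    and st: "s \<le> t"
  shows "\<bar>u t - u s\<bar> \<le> sqrt (2 * (3 * C + 2)) * (t - s)"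
proof -
  have u: "continuous_on {0..1} u" by (rule jet_solutionD[OF sol])
  have C: "C \<ge> 0" using V[of 0] by linarith
  obtain tM where tM: "tM \<in> {0..1}" "\<And>x. x \<in> {0..1} \<Longrightarrow> u x \<le> u tM"
    using continuous_attains_sup[OF _ _ u] by auto
  obtain tm where tm: "tm \<in> {0..1}" "\<And>x. x \<in> {0..1} \<Longrightarrow> u tm \<le> u x"
    using continuous_attains_inf[OF _ _ u] by auto
  have frac01: "frac x \<in> {0..1}" for x :: real
    using frac_ge_0[of x] frac_lt_1[of x] by auto
  have max: "u x \<le> u tM" and min: "u tm \<le> u x" for x
    using tM(2)[OF frac01] tm(2)[OF frac01] periodic_frac[OF per] by metis+
  have "V tm + lam * u tm = 0" by (rule energy_zero_at_local_min[OF sol]) (simp add: min)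
  then have "lam * u tm \<le> 0" using V(1)[of tm] by linarith
  then have tm0: "u tm \<le> 0" using lam by (simp add: mult_le_0_iff)
  define M where "M = max 0 (u tM)"
  have M: "0 \<le> M" "u x \<le> M" for x by (auto simp: M_def le_max_iff_disj max)
  have E: "V x + lam * u x \<le> C + M" for x
  proof -
    have "lam * u x \<le> lam * M" using lam M by (intro mult_left_mono) auto
    also have "\<dots> \<le> M" using lam M(1) by (simp add: mult_left_le_one_le)
    finally show ?thesis using V(2)[of x] by linarith
  qed
  have "(sqrt (2 * (C + M)))\<^sup>2 / 2 = C + M" using C M(1) by simp
  then have E': "V x + lam * u x \<le> (sqrt (2 * (C + M)))\<^sup>2 / 2" for x using E[of x] by linarith
  have slope: "\<bar>u b - u a\<bar> \<le> sqrt (2 * (C + M)) * (b - a)" if "a \<le> b" for a b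
    by (rule slope_bound[OF sol that _ E']) (use C M(1) in simp)
  have "u tM - u tm \<le> sqrt (2 * (C + M)) * \<bar>tM - tm\<bar>"
    using slope[of tM tm] slope[of tm tM] by (cases "tM \<le> tm") auto
  also have "\<dots> \<le> sqrt (2 * (C + M)) * 1" using tM tm C M(1) by (intro mult_left_mono) auto
  finally have "M \<le> sqrt (2 * (C + M))" using tm0 C M(1) by (auto simp: M_def max_def)
  then have "M\<^sup>2 \<le> (sqrt (2 * (C + M)))\<^sup>2" using M(1) by (intro power_mono) auto
  then have q: "M * M \<le> 2 * (C + M)" using C M(1) by (simp add: power2_eq_square)
  have "M \<le> 2 + 2 * C"
  proof (rule ccontr)
    assume "\<not> ?thesis"
    then have "M > 2 + 2 * C" by simp
    moreover from this have "M * (2 + 2 * C) < M * M" using C by (intro mult_strict_left_mono) auto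
    moreover have "2 * C * 1 \<le> 2 * C * M" using \<open>M > 2 + 2 * C\<close> C by (intro mult_left_mono) auto
    ultimately show False using q by (simp add: algebra_simps)
  qed
  then have "sqrt (2 * (C + M)) \<le> sqrt (2 * (3 * C + 2))" by simp
  then have "sqrt (2 * (C + M)) * (t - s) \<le> sqrt (2 * (3 * C + 2)) * (t - s)"
    using st by (intro mult_right_mono) auto
  then show ?thesis using slope[OF st] by linarith
qed

section \<open>Uniqueness\<close>

text \<open>The quantity \<open>q = (f - g)\<^sup>2 (1 - t) / t\<close> is nonincreasing and tends to 0 at 0, hence vanishes. For
  the monotonicity, \<open>f' - g' = 2 lam (f - g) / (f' + g')\<close> and \<open>f' + g' \<ge> 2 kappa t (1 - t)\<close>, so
  \<open>lam \<le> kappa / 2\<close> gives \<open>2 t (1 - t) (f - g) (f' - g') \<le> (f - g)\<^sup>2\<close>; the weight \<open>(1 - t) / t\<close> has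
  logarithmic derivative \<open>- 1 / (t (1 - t))\<close>, just enough to absorb this. The limit is 0 because
  \<open>\<bar>f - g\<bar> \<le> L t\<close>.\<close>

lemma increasing_branch_unique:
  assumes f: "jet_solution lam V f" "mono_on {0..m} f" "f 0 = 0" "\<And>t. 0 \<le> f t"
      "\<And>t. 0 \<le> t \<Longrightarrow> f t \<le> L * t"
    and g: "jet_solution lam V g" "mono_on {0..m} g" "g 0 = 0" "\<And>t. 0 \<le> g t"
      "\<And>t. 0 \<le> t \<Longrightarrow> g t \<le> L * t"
    and V: "\<And>t. t \<in> {0..1} \<Longrightarrow> (kappa * (t * (1 - t)))\<^sup>2 \<le> 2 * V t"
    and lam: "0 < lam" "lam \<le> kappa / 2" and m: "m < 1" and t: "t \<in> {0..m}"
  shows "f t = g t"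
proof -
  let ?F = "\<lambda>t. sqrt (2 * (V t + lam * f t))" and ?G = "\<lambda>t. sqrt (2 * (V t + lam * g t))"
  have eq: "f t = g t" if t: "0 < t" "t < m" for t
  proof -
    define q where "q = (\<lambda>t. (f t - g t)\<^sup>2 * (1 - t) / t)"
    have anti: "q t \<le> q s" if s: "0 < s" "s \<le> t" for s
    proof (rule DERIV_nonpos_imp_nonincreasing[OF s(2)])
      fix x assume "s \<le> x" "x \<le> t"
      then have x: "0 < x" "x < m" "x < 1" using s t m by auto
      define d e w where "d = f x - g x" and "e = ?F x - ?G x" and "w = x * (1 - x)"
      have w: "w > 0" using x by (simp add: w_def)
      have D: "(q has_real_derivative
          ((2 * (f x - g x) * (?F x - ?G x) * (1 - x) + (f x - g x)\<^sup>2 * (0 - 1)) * x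
            - (f x - g x)\<^sup>2 * (1 - x) * 1) / (x * x)) (at x)"
        unfolding q_def
        using deriv_if_mono[OF f(1,2) x(1,2)] deriv_if_mono[OF g(1,2) x(1,2)] x
        by (auto intro!: derivative_eq_intros)
      have low: "kappa * w \<le> sqrt (2 * (V x + lam * h))" if "h \<ge> 0" for h
      proof (rule real_le_rsqrt)
        have "(kappa * w)\<^sup>2 \<le> 2 * V x" using V[of x] x by (auto simp: w_def)
        also have "\<dots> \<le> 2 * (V x + lam * h)" using that lam by simp
        finally show "(kappa * w)\<^sup>2 \<le> 2 * (V x + lam * h)" .
      qed
      have FG: "2 * (kappa * w) \<le> ?F x + ?G x" using low[OF f(4)[of x]] low[OF g(4)[of x]] by linarith
      have "kappa * w > 0" using lam w by simp
      then have pos: "?F x + ?G x > 0" using FG by linarith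
      have "(?F x)\<^sup>2 - (?G x)\<^sup>2 = 2 * lam * d"
        using sqrt_energy(1)[OF f(1), of x] sqrt_energy(1)[OF g(1), of x]
        by (simp add: d_def algebra_simps)
      then have prod: "e * (?F x + ?G x) = 2 * lam * d"
        unfolding e_def by (simp add: power2_eq_square algebra_simps)
      have de: "d * e * (?F x + ?G x) = 2 * lam * d\<^sup>2"
        using prod by (simp add: power2_eq_square mult.assoc)
      then have "0 \<le> d * e * (?F x + ?G x)" using lam by simp
      then have "0 \<le> d * e" using pos by (simp add: zero_le_mult_iff)
      then have "d * e * (2 * (kappa * w)) \<le> d * e * (?F x + ?G x)" using FG by (rule mult_left_mono[rotated])
      also have "\<dots> \<le> kappa * d\<^sup>2" unfolding de using lam by (intro mult_right_mono) auto
      finally have "kappa * (2 * (d * e) * w) \<le> kappa * d\<^sup>2" by (simp add: mult_ac)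
      then have "2 * (d * e) * w \<le> d\<^sup>2" using lam by simp
      then have "((2 * d * e * (1 - x) + d\<^sup>2 * (0 - 1)) * x - d\<^sup>2 * (1 - x) * 1) / (x * x) \<le> 0"
        using x by (intro divide_nonpos_pos) (auto simp: w_def algebra_simps)
      with D show "\<exists>y. (q has_real_derivative y) (at x) \<and> y \<le> 0" unfolding d_def e_def by blast
    qed
    have "q t \<le> L\<^sup>2 * s" if s: "0 < s" "s \<le> t" for s
    proof -
      have "\<bar>f s - g s\<bar> \<le> L * s" using f(4,5)[of s] g(4,5)[of s] s by (auto simp: abs_le_iff)
      then have "(f s - g s)\<^sup>2 \<le> (L * s)\<^sup>2" by (simp add: abs_le_square_iff[symmetric])
      then have "(f s - g s)\<^sup>2 * (1 - s) \<le> (L * s)\<^sup>2 * 1" using s t m by (intro mult_mono) auto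
      then have "q s \<le> L\<^sup>2 * s" using s(1) by (simp add: q_def power2_eq_square field_simps)
      then show ?thesis using anti[OF s] by linarith
    qed
    then have "\<forall>\<^sub>F s in at_right 0. q t \<le> L\<^sup>2 * s"
      unfolding eventually_at_right_field using t by (intro exI[of _ t]) auto
    moreover have "((\<lambda>s. L\<^sup>2 * s) \<longlongrightarrow> L\<^sup>2 * 0) (at_right 0)" by (intro tendsto_intros)
    ultimately have "q t \<le> L\<^sup>2 * 0" by (intro tendsto_lowerbound) auto
    then have "(f t - g t)\<^sup>2 * (1 - t) \<le> 0" using t by (simp add: q_def divide_le_0_iff)
    then have "(f t - g t)\<^sup>2 \<le> 0" using t m by (simp add: mult_le_0_iff)
    then show ?thesis by simp
  qed
  show ?thesis
  proof (cases "m = 0")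
    case True then show ?thesis using t f(3) g(3) by auto
  next
    case False
    then have cl: "closure {0<..<m} = {0..m}" using t by simp
    have "continuous_on (closure {0<..<m}) (\<lambda>t. f t - g t)"
      by (intro continuous_intros jet_solutionD(2)[OF f(1)] jet_solutionD(2)[OF g(1)])
    then have "f t - g t = 0"
      by (rule continuous_constant_on_closure) (use eq t cl in auto)
    then show ?thesis by simp
  qed
qed

text \<open>What the proof uses about the potential: if \<open>kappa\<close> and \<open>eta\<close> are positive, \<open>V\<close>
  grows at least quadratically from both ends of \<open>[0, 1]\<close> (the symmetric form makes the bound invariant under the reflection \<open>1 - t\<close>), and its
  critical points inside have values at least \<open>eta\<close>.\<close>

locale potential_well =
  fixes V V' :: "real \<Rightarrow> real" and kappa eta C :: real
  assumes V_per: "V (t + of_int n) = V t"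
    and V_deriv: "(V has_real_derivative V' t) (at t)"
    and V_zero: "V 0 = 0"
    and V_lower: "t \<in> {0..1} \<Longrightarrow> (kappa * (t * (1 - t)))\<^sup>2 \<le> 2 * V t"
    and V_upper: "V t \<le> C"
    and V_critical: "0 < t \<Longrightarrow> t < 1 \<Longrightarrow> V t < eta \<Longrightarrow> V' t \<noteq> 0"
begin

lemma V_nonneg: "0 \<le> V t"
proof -
  have "(kappa * (frac t * (1 - frac t)))\<^sup>2 \<le> 2 * V (frac t)"
    using frac_ge_0[of t] frac_lt_1[of t] by (intro V_lower) auto
  then have "0 \<le> 2 * V (frac t)" by (rule order_trans[OF zero_le_power2])
  then show ?thesis using periodic_frac[of V, OF V_per] by simp
qed

lemma solution_shape:
  assumes sol: "jet_solution lam V u" and per: "\<And>t n. u (t + of_int n) = u t"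
    and lam: "0 < lam" "lam \<le> 1" "lam * sqrt (2 * (3 * C + 2)) < eta"
  obtains m where "0 < m" "m < 1" "mono_on {0..m} u" "mono_on {0..1 - m} (\<lambda>t. u (1 - t))"
    "u 0 = 0" "\<And>t. 0 \<le> u t" "\<And>t. 0 \<le> t \<Longrightarrow> u t \<le> sqrt (2 * (3 * C + 2)) * t"
    "\<And>t. 0 \<le> t \<Longrightarrow> u (1 - t) \<le> sqrt (2 * (3 * C + 2)) * t"
proof -
  let ?L = "sqrt (2 * (3 * C + 2))"
  have slope: "\<bar>u t - u s\<bar> \<le> ?L * (t - s)" if "s \<le> t" for s t
    by (rule periodic_slope_bound[where V = V and lam = lam])
      (use sol per lam V_nonneg V_upper that in auto)
  have C: "C \<ge> 0" using V_upper[of 0] V_zero by simp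
  have u0: "u 0 \<ge> 0" using energy_nonneg[OF sol, of 0] V_zero lam by (simp add: zero_le_mult_iff)
  have no_min: "\<not> (\<forall>\<^sub>F s in nhds y. u y \<le> u s)" if y: "0 < y" "y < 1" for y
  proof
    assume min: "\<forall>\<^sub>F s in nhds y. u y \<le> u s"
    have "\<bar>u y - u 0\<bar> \<le> ?L * y" using slope[of 0 y] y by simp
    also have "\<dots> \<le> ?L * 1" using y C by (intro mult_left_mono) auto
    finally have "- u y \<le> ?L" using u0 by linarith
    then have "lam * - u y \<le> lam * ?L" using lam by (intro mult_left_mono) auto
    then have "V y < eta" using energy_zero_at_local_min[OF sol min] lam by simp
    moreover have "V' y = 0" by (rule critical_at_local_min[OF sol min V_deriv])
    ultimately show False using V_critical y by blast
  qed
  have u: "continuous_on A u" for A by (rule jet_solutionD[OF sol])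
  have frac01: "frac x \<in> {0..1}" for x :: real
    using frac_ge_0[of x] frac_lt_1[of x] by auto
  have u1: "u 1 = u 0" using per[of 0 1] by simp
  obtain z where z: "z \<in> {0..1}" "\<And>x. x \<in> {0..1} \<Longrightarrow> u z \<le> u x"
    using continuous_attains_inf[OF _ _ u[of "{0..1}"]] by auto
  have min: "u z \<le> u x" for x using z(2)[OF frac01] periodic_frac[OF per] by metis
  have zmin: "\<forall>\<^sub>F s in nhds z. u z \<le> u s" by (simp add: min)
  then have "z = 0 \<or> z = 1" using no_min[of z] z(1) by (auto simp: less_le)
  then have uz: "u z = u 0" using u1 by auto
  have "V z = 0" using \<open>z = 0 \<or> z = 1\<close> V_zero V_per[of 0 1] by auto
  then have u00: "u 0 = 0" using energy_zero_at_local_min[OF sol zmin] lam uz by simp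
  have nonneg: "0 \<le> u t" for t using min uz u00 by simp
  obtain m where m: "m \<in> {0..1}" "\<And>x. x \<in> {0..1} \<Longrightarrow> u x \<le> u m"
    using continuous_attains_sup[OF _ _ u[of "{0..1}"]] by auto
  have "m \<noteq> 0 \<and> m \<noteq> 1"
  proof (rule ccontr)
    assume "\<not> ?thesis"
    then have "u m = 0" using u1 u00 by auto
    then have "u (1/2) = 0" using m(2)[of "1/2"] nonneg[of "1/2"] by auto
    then show False using no_min[of "1/2"] nonneg by simp
  qed
  then have m01: "0 < m" "m < 1" using m(1) by auto
  have "mono_on {0..m} u"
    by (rule mono_on_if_no_local_min[OF u]) (use no_min m m01 in auto)
  moreover have "mono_on {0..1 - m} (\<lambda>t. u (1 - t))"
  proof (rule mono_on_if_no_local_min)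
    show "continuous_on {0..1 - m} (\<lambda>t. u (1 - t))"
      by (rule continuous_on_compose2[OF u[of UNIV]]) (auto intro!: continuous_intros)
    fix y assume y: "0 < y" "y < 1 - m"
    show "\<not> (\<forall>\<^sub>F s in nhds y. u (1 - y) \<le> u (1 - s))"
    proof
      assume "\<forall>\<^sub>F s in nhds y. u (1 - y) \<le> u (1 - s)"
      then obtain d where d: "d > 0" "\<And>s. dist s y < d \<Longrightarrow> u (1 - y) \<le> u (1 - s)"
        unfolding eventually_nhds_metric by blast
      have "u (1 - y) \<le> u s" if "dist s (1 - y) < d" for s
        using d(2)[of "1 - s"] that by (auto simp: dist_real_def abs_minus_commute algebra_simps)
      with d(1) have "\<forall>\<^sub>F s in nhds (1 - y). u (1 - y) \<le> u s"
        unfolding eventually_nhds_metric by blast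
      then show False using no_min[of "1 - y"] y m01 by auto
    qed
  qed (use m m01 in auto)
  moreover have "u t \<le> ?L * t" "u (1 - t) \<le> ?L * t" if "0 \<le> t" for t
    using slope[of 0 t] slope[of "1 - t" 1] that u00 u1 by (auto simp: abs_le_iff)
  ultimately show ?thesis using that m01 u00 nonneg by blast
qed

lemma solution_unique:
  assumes u: "jet_solution lam V u" "\<And>t n. u (t + of_int n) = u t"
    and v: "jet_solution lam V v" "\<And>t n. v (t + of_int n) = v t"
    and lam: "0 < lam" "lam \<le> 1" "lam * sqrt (2 * (3 * C + 2)) < eta" "lam \<le> kappa / 2"
    and t: "t \<in> {0..1}"
  shows "u t = v t"
proof -
  obtain m where m: "0 < m" "m < 1" "mono_on {0..m} u" "mono_on {0..1 - m} (\<lambda>t. u (1 - t))"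
    "u 0 = 0" "\<And>t. 0 \<le> u t" "\<And>t. 0 \<le> t \<Longrightarrow> u t \<le> sqrt (2 * (3 * C + 2)) * t"
    "\<And>t. 0 \<le> t \<Longrightarrow> u (1 - t) \<le> sqrt (2 * (3 * C + 2)) * t"
    using solution_shape[OF u lam(1-3)] by blast
  obtain n where n: "0 < n" "n < 1" "mono_on {0..n} v" "mono_on {0..1 - n} (\<lambda>t. v (1 - t))"
    "v 0 = 0" "\<And>t. 0 \<le> v t" "\<And>t. 0 \<le> t \<Longrightarrow> v t \<le> sqrt (2 * (3 * C + 2)) * t"
    "\<And>t. 0 \<le> t \<Longrightarrow> v (1 - t) \<le> sqrt (2 * (3 * C + 2)) * t"
    using solution_shape[OF v lam(1-3)] by blast
  have uv1: "u 1 = 0" "v 1 = 0" using u(2)[of 0 1] v(2)[of 0 1] m(5) n(5) by auto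
  let ?k = "min m n" and ?l = "max m n"
  have left: "u s = v s" if "s \<in> {0..?k}" for s
  proof (rule increasing_branch_unique[where V = V and lam = lam and m = ?k
        and L = "sqrt (2 * (3 * C + 2))" and kappa = kappa and f = u and g = v and t = s])
    show "mono_on {0..?k} u" "mono_on {0..?k} v"
      using mono_on_subset[OF m(3)] mono_on_subset[OF n(3)] by auto
  qed (use u v m n V_lower lam that in auto)
  have right: "u s = v s" if s: "s \<in> {?l..1}" for s
  proof -
    have "u (1 - (1 - s)) = v (1 - (1 - s))"
    proof (rule increasing_branch_unique[where V = "\<lambda>t. V (1 - t)" and lam = lam and m = "1 - ?l"
          and L = "sqrt (2 * (3 * C + 2))" and kappa = kappa
          and f = "\<lambda>t. u (1 - t)" and g = "\<lambda>t. v (1 - t)" and t = "1 - s"])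
      show "mono_on {0..1 - ?l} (\<lambda>t. u (1 - t))" "mono_on {0..1 - ?l} (\<lambda>t. v (1 - t))"
        using mono_on_subset[OF m(4)] mono_on_subset[OF n(4)] by auto
      show "(kappa * (x * (1 - x)))\<^sup>2 \<le> 2 * V (1 - x)" if "x \<in> {0..1}" for x
        using V_lower[of "1 - x"] that by (simp add: mult.commute)
    qed (use jet_solution_reflect u(1) v(1) m n lam uv1 s in auto)
    then show ?thesis by simp
  qed
  have mono: "mono_on {0..m} u" "mono_on {0..n} v" by fact+
  have anti_u: "u y \<le> u x" if "m \<le> x" "x \<le> y" "y \<le> 1" for x y
    using mono_onD[OF m(4), of "1 - y" "1 - x"] that by auto
  have anti_v: "v y \<le> v x" if "n \<le> x" "x \<le> y" "y \<le> 1" for x y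
    using mono_onD[OF n(4), of "1 - y" "1 - x"] that by auto
  \<comment> \<open>The maximum points need not be known to coincide: between them one solution increases and the
    other decreases, while they agree at both ends, so both are constant there.\<close>
  consider "t \<le> ?k" | "?l \<le> t" | "?k < t" "t < ?l" by linarith
  then show ?thesis
  proof cases
    case 3
    have k: "u ?k = v ?k" and l: "u ?l = v ?l" using left[of ?k] right[of ?l] m n by auto
    show ?thesis
    proof (cases "m \<le> n")
      case True
      then have t: "m \<le> t" "t \<le> n" "0 \<le> t" "n \<le> 1" "0 \<le> m" using 3 m(1) n(2) by auto
      have "u n \<le> u t" "u t \<le> u m" by (rule anti_u; use t in linarith)+
      moreover have "v m \<le> v t" "v t \<le> v n" by (rule mono_onD[OF mono(2)]; use t in simp)+
      moreover have "u m = v m" "u n = v n" using k l True by auto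
      ultimately show ?thesis by linarith
    next
      case False
      then have t: "n \<le> t" "t \<le> m" "0 \<le> t" "m \<le> 1" "0 \<le> n" using 3 m(2) n(1) by auto
      have "v m \<le> v t" "v t \<le> v n" by (rule anti_v; use t in linarith)+
      moreover have "u n \<le> u t" "u t \<le> u m" by (rule mono_onD[OF mono(1)]; use t in simp)+
      moreover have "u m = v m" "u n = v n" using k l False by auto
      ultimately show ?thesis by linarith
    qed
  qed (use left right t in auto)
qed

end

section \<open>Nondegenerate minima\<close>

text \<open>Since \<open>V'\<close> has derivative \<open>k > 0\<close> at its zero 0, the functions \<open>V' t - k t / 2\<close> and \<open>t\<close> have the
  same sign near 0. This gives \<open>V t \<ge> k t\<^sup>2 / 4\<close> and excludes critical points other than 0 there; on
  the rest of a period \<open>V\<close> is at least some \<open>eta > 0\<close> by compactness.\<close>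

lemma nondegenerate_min_potential_well:
  fixes V V' :: "real \<Rightarrow> real"
  assumes per: "\<And>t n. V (t + of_int n) = V t" and D: "\<And>t. (V has_real_derivative V' t) (at t)"
    and V0: "V 0 = 0" and pos: "\<And>t. 0 < t \<Longrightarrow> t < 1 \<Longrightarrow> 0 < V t"
    and D2: "(V' has_real_derivative k) (at 0)" and k: "k > 0"
  obtains kappa eta C where "kappa > 0" "eta > 0" "potential_well V V' kappa eta C"
proof -
  have cont: "continuous_on A V" for A
    using D DERIV_isCont continuous_at_imp_continuous_on by blast
  have nonneg: "0 \<le> V t" for t
  proof -
    consider "frac t = 0" | "0 < frac t" using frac_ge_0[of t] by linarith
    then have "0 \<le> V (frac t)"
    proof cases
      case 1 show ?thesis unfolding 1 V0 by simp
    next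
      case 2 show ?thesis using pos[OF 2 frac_lt_1] by (rule less_imp_le)
    qed
    then show ?thesis using periodic_frac[of V, OF per] by simp
  qed
  have V'0: "V' 0 = 0" by (rule DERIV_local_min[OF D, of 1]) (use V0 nonneg in auto)
  have "((\<lambda>t. V' t - k / 2 * t) has_real_derivative k - k / 2) (at 0)"
    by (auto intro!: derivative_eq_intros D2)
  then have D2': "((\<lambda>t. V' t - k / 2 * t) has_real_derivative k / 2) (at 0)" by simp
  obtain d1 where d1: "d1 > 0" "\<And>h. 0 < h \<Longrightarrow> h < d1 \<Longrightarrow> k / 2 * h < V' h"
    using DERIV_pos_inc_right[OF D2'] k V'0 by auto
  have "0 < k / 2" using k by simp
  then obtain d2 where d2': "d2 > 0"
    "\<And>h. 0 < h \<Longrightarrow> h < d2 \<Longrightarrow> V' (0 - h) - k / 2 * (0 - h) < V' 0 - k / 2 * 0"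
    using DERIV_pos_inc_left[OF D2'] by blast
  have d2: "V' (- h) < - (k / 2 * h)" if "0 < h" "h < d2" for h
    using d2'(2)[OF that] V'0 by simp
  define d where "d = min (min (d1/2) (d2/2)) (1/4)"
  have d: "0 < d" "d < d1" "d < d2" "d \<le> 1/4" using d1(1) d2'(1) by (auto simp: d_def)
  have DQ: "((\<lambda>t. V t - k / 4 * t\<^sup>2) has_real_derivative V' t - k / 2 * t) (at t)" for t
  proof -
    have "((\<lambda>t. V t - k / 4 * t\<^sup>2) has_real_derivative V' t - k / 4 * (2 * t)) (at t)"
      by (intro DERIV_diff D DERIV_cmult) (auto intro!: derivative_eq_intros)
    then show ?thesis by simp
  qed
  have quad_right: "k / 4 * t\<^sup>2 \<le> V t" if t: "0 \<le> t" "t \<le> d" for t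
  proof -
    have "V 0 - k / 4 * 0\<^sup>2 \<le> V t - k / 4 * t\<^sup>2"
    proof (rule DERIV_nonneg_imp_nondecreasing[OF t(1)])
      fix x assume x: "0 \<le> x" "x \<le> t"
      have "0 \<le> V' x - k / 2 * x" using d1(2)[of x] x t d V'0 by (cases "x = 0") auto
      then show "\<exists>y. ((\<lambda>t. V t - k / 4 * t\<^sup>2) has_real_derivative y) (at x) \<and> 0 \<le> y" using DQ by blast
    qed
    then show ?thesis using V0 by simp
  qed
  have quad_left: "k / 4 * t\<^sup>2 \<le> V (- t)" if t: "0 \<le> t" "t \<le> d" for t
  proof -
    have "V 0 - k / 4 * 0\<^sup>2 \<le> V (- t) - k / 4 * (- t)\<^sup>2"
    proof (rule DERIV_nonpos_imp_nonincreasing[where f = "\<lambda>t. V t - k / 4 * t\<^sup>2" and a = "- t" and b = 0])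
      show "- t \<le> 0" using t by simp
      fix x assume x: "- t \<le> x" "x \<le> 0"
      have "V' x - k / 2 * x \<le> 0" using d2[of "- x"] x t d V'0 by (cases "x = 0") auto
      then show "\<exists>y. ((\<lambda>t. V t - k / 4 * t\<^sup>2) has_real_derivative y) (at x) \<and> y \<le> 0" using DQ by blast
    qed
    then show ?thesis using V0 by simp
  qed
  have "\<exists>z\<in>{d..1 - d}. \<forall>x\<in>{d..1 - d}. V z \<le> V x"
    by (rule continuous_attains_inf[OF _ _ cont]) (use d in auto)
  then obtain z where z: "z \<in> {d..1 - d}" "\<And>x. x \<in> {d..1 - d} \<Longrightarrow> V z \<le> V x" by blast
  define eta where "eta = V z"
  have eta: "0 < eta" using pos[of z] z(1) d(1) by (auto simp: eta_def)
  have "\<exists>z\<in>{0..1}. \<forall>x\<in>{0..1}. V x \<le> V z"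
    by (rule continuous_attains_sup[OF _ _ cont]) auto
  then obtain y where y: "\<And>x. x \<in> {0..1} \<Longrightarrow> V x \<le> V y" by blast
  define kappa where "kappa = sqrt (min (k / 2) (2 * eta))"
  have "kappa\<^sup>2 = min (k / 2) (2 * eta)" using k eta by (simp add: kappa_def)
  moreover have "kappa > 0" using k eta by (simp add: kappa_def)
  ultimately have kappa: "kappa > 0" "kappa\<^sup>2 \<le> k / 2" "kappa\<^sup>2 \<le> 2 * eta" by auto
  have sq: "(kappa * (t * (1 - t)))\<^sup>2 \<le> (kappa * t)\<^sup>2" "(kappa * (t * (1 - t)))\<^sup>2 \<le> (kappa * (1 - t))\<^sup>2"
    "(kappa * (t * (1 - t)))\<^sup>2 \<le> kappa\<^sup>2" if "t \<in> {0..1}" for t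
  proof -
    have 1: "t * (1 - t) \<le> t" "t * (1 - t) \<le> 1 - t" "0 \<le> t * (1 - t)" "0 \<le> kappa"
      using that kappa by (auto simp: mult_left_le mult_left_le_one_le)
    then have 2: "t * (1 - t) \<le> 1" using that by auto
    show "(kappa * (t * (1 - t)))\<^sup>2 \<le> (kappa * t)\<^sup>2" "(kappa * (t * (1 - t)))\<^sup>2 \<le> (kappa * (1 - t))\<^sup>2"
      using 1 by (auto intro!: power_mono mult_left_mono)
    have "(kappa * (t * (1 - t)))\<^sup>2 \<le> (kappa * 1)\<^sup>2" using 1 2 by (intro power_mono mult_left_mono) auto
    then show "(kappa * (t * (1 - t)))\<^sup>2 \<le> kappa\<^sup>2" by simp
  qed
  have V_left: "V (1 - t) = V (- t)" for t using per[of "- t" 1] by simp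
  have "potential_well V V' kappa eta (V y)"
  proof
    fix t :: real
    have "V (frac t) \<le> V y" by (rule y) (use frac_ge_0[of t] frac_lt_1[of t] in simp)
    then show "V t \<le> V y" using periodic_frac[of V, OF per] by simp
    show "(kappa * (t * (1 - t)))\<^sup>2 \<le> 2 * V t" if t: "t \<in> {0..1}"
    proof -
      consider "t \<le> d" | "1 - t \<le> d" | "d \<le> t" "t \<le> 1 - d" by linarith
      then show ?thesis
      proof cases
        case 1
        have "(kappa * t)\<^sup>2 \<le> k / 2 * t\<^sup>2" unfolding power_mult_distrib using kappa by (intro mult_right_mono) auto
        then show ?thesis using quad_right[of t] 1 t sq(1)[OF t] by auto
      next
        case 2
        have "(kappa * (1 - t))\<^sup>2 \<le> k / 2 * (1 - t)\<^sup>2"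
          unfolding power_mult_distrib using kappa by (intro mult_right_mono) auto
        moreover have "k / 4 * (1 - t)\<^sup>2 \<le> V t" using quad_left[of "1 - t"] V_left[of "1 - t"] 2 t by auto
        ultimately show ?thesis using sq(2)[OF t] by linarith
      next
        case 3
        then show ?thesis using z(2)[of t] kappa(3) sq(3)[OF t] by (simp add: eta_def)
      qed
    qed
    show "V' t \<noteq> 0" if t: "0 < t" "t < 1" "V t < eta"
    proof -
      have "t \<notin> {d..1 - d}" using t(3) z(2)[of t] by (auto simp: eta_def)
      then consider "t < d" | "1 - t < d" by force
      then show ?thesis
      proof cases
        case 1
        have "0 < k / 2 * t" using k t(1) by (intro mult_pos_pos) auto
        then show ?thesis using d1(2)[of t] 1 t d by auto
      next
        case 2
        have "((\<lambda>s. V (s + 1)) has_real_derivative V' (- (1 - t) + 1)) (at (- (1 - t)))"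
          using D[of "- (1 - t) + 1"] DERIV_shift[of V "V' (- (1 - t) + 1)" "- (1 - t)" 1] by blast
        moreover have "(\<lambda>s. V (s + 1)) = V" using per[of _ 1] by auto
        ultimately have "(V has_real_derivative V' (- (1 - t) + 1)) (at (- (1 - t)))" by metis
        then have "V' (- (1 - t) + 1) = V' (- (1 - t))" by (rule DERIV_unique[OF _ D[of "- (1 - t)"]])
        then have "V' (- (1 - t)) = V' t" by simp
        moreover have "0 < k / 2 * (1 - t)" using k t(2) by (intro mult_pos_pos) auto
        ultimately show ?thesis using d2[of "1 - t"] 2 t d by auto
      qed
    qed
  qed (use per D V0 in auto)
  then show ?thesis using that kappa(1) eta by blast
qed

section \<open>Existence\<close>

text \<open>Picard iteration from 0. The right side is increasing in \<open>f\<close>, so the iterates increase and no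
  Lipschitz condition is needed; dominated convergence passes to the limit.\<close>

lemma increasing_branch_exists:
  fixes V :: "real \<Rightarrow> real"
  assumes V: "continuous_on {0..1} V" and V0: "\<And>t. t \<in> {0..1} \<Longrightarrow> 0 \<le> V t" and lam: "0 \<le> lam"
  obtains f where "f 0 = 0" "\<And>t. t \<in> {0..1} \<Longrightarrow> 0 \<le> f t"
    "\<And>t. t \<in> {0..1} \<Longrightarrow> (f has_real_derivative sqrt (2 * (V t + lam * f t))) (at t within {0..1})"
proof -
  have "\<exists>z\<in>{0..1}. \<forall>x\<in>{0..1}. V x \<le> V z"
    by (rule continuous_attains_sup[OF _ _ V]) auto
  then obtain C where C: "\<And>x. x \<in> {0..1} \<Longrightarrow> V x \<le> C" "0 \<le> C" using V0 by blast
  \<comment> \<open>any \<open>B\<close> with \<open>2 (C + lam B) \<le> B\<^sup>2\<close> bounds all iterates\<close>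
  define B where "B = 2 * lam + 2 * C + 1"
  have B: "0 \<le> B" "1 \<le> B" using lam C by (auto simp: B_def)
  define S where "S = (\<lambda>f t. sqrt (2 * (V t + lam * f t)))"
  define T where "T = (\<lambda>f t. integral {0..t} (S f))"
  define F where "F = rec_nat (\<lambda>_. 0) (\<lambda>_. T)"
  have F0: "F 0 = (\<lambda>_. 0)" and FS: "F (Suc n) = T (F n)" for n by (auto simp: F_def)
  have S_le: "S f t \<le> B" if "t \<in> {0..1}" "f t \<le> B" for f t
  proof -
    have "lam * f t \<le> lam * B" using lam that by (intro mult_left_mono)
    moreover have "C \<le> C * B" using mult_left_mono[OF B(2) C(2)] by simp
    moreover have "B * B = 2 * (lam * B) + 2 * (C * B) + B" by (simp add: B_def algebra_simps)
    moreover have "V t \<le> C" using C that by auto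
    ultimately have "2 * (V t + lam * f t) \<le> B * B" using B(1) unfolding distrib_left by linarith
    then have "2 * (V t + lam * f t) \<le> B\<^sup>2" by (simp add: power2_eq_square)
    then show ?thesis unfolding S_def using B by (intro real_le_lsqrt) auto
  qed
  have S_ge: "0 \<le> S f t" if "t \<in> {0..1}" "0 \<le> f t" for f t
    using that V0[of t] lam by (simp add: S_def)
  have S_mono: "S f t \<le> S g t" if "f t \<le> g t" for f g t
    using that lam by (simp add: S_def mult_left_mono)
  have S_cont: "continuous_on {0..1} (S f)" if "continuous_on {0..1} f" for f
    unfolding S_def by (intro continuous_intros V that)
  have S_int: "S f integrable_on {0..t}" if "continuous_on {0..1} f" "t \<in> {0..1}" for f t
    by (rule integrable_continuous_real, rule continuous_on_subset[OF S_cont[OF that(1)]]) (use that in auto)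
  have T_bounds: "0 \<le> T f t \<and> T f t \<le> B"
    if f: "continuous_on {0..1} f" "\<And>s. s \<in> {0..1} \<Longrightarrow> 0 \<le> f s \<and> f s \<le> B" and t: "t \<in> {0..1}" for f t
  proof
    show "0 \<le> T f t" unfolding T_def
      by (rule integral_nonneg[OF S_int[OF f(1) t]]) (use t S_ge f in auto)
    have "T f t \<le> integral {0..t} (\<lambda>_. B)" unfolding T_def
      by (rule integral_le[OF S_int[OF f(1) t]]) (use t S_le f in auto)
    also have "\<dots> = t * B" using t by simp
    also have "\<dots> \<le> 1 * B" using t B by (intro mult_right_mono) auto
    finally show "T f t \<le> B" by simp
  qed
  have T_cont: "continuous_on {0..1} (T f)" if "continuous_on {0..1} f" for f
    unfolding T_def by (rule indefinite_integral_continuous_1) (use S_int[OF that, of 1] in auto)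
  have F: "continuous_on {0..1} (F n) \<and> (\<forall>t\<in>{0..1}. 0 \<le> F n t \<and> F n t \<le> B)" for n
  proof (induction n)
    case 0 then show ?case using B by (simp add: F0)
  next
    case (Suc n) then show ?case unfolding FS using T_cont T_bounds by blast
  qed
  have F_inc: "\<forall>t\<in>{0..1}. F n t \<le> F (Suc n) t" for n
  proof (induction n)
    case 0 then show ?case using F[of "Suc 0"] by (simp add: F0)
  next
    case (Suc n)
    show ?case
    proof
      fix t :: real assume t: "t \<in> {0..1}"
      have "T (F n) t \<le> T (F (Suc n)) t" unfolding T_def
        by (rule integral_le) (use S_int F t Suc S_mono in auto)
      then show "F (Suc n) t \<le> F (Suc (Suc n)) t" by (simp add: FS)
    qed
  qed
  define f where "f = (\<lambda>t. lim (\<lambda>n. F n t))"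
  have lim: "(\<lambda>n. F n t) \<longlonglongrightarrow> f t" if t: "t \<in> {0..1}" for t
  proof -
    have "incseq (\<lambda>n. F n t)" using F_inc t by (intro incseq_SucI) auto
    moreover have "F n t \<le> B" for n using F t by auto
    ultimately obtain l where "(\<lambda>n. F n t) \<longlonglongrightarrow> l" using incseq_convergent by blast
    then show ?thesis unfolding f_def using convergent_LIMSEQ_iff convergentI by blast
  qed
  have f_bounds: "0 \<le> f t" if "t \<in> {0..1}" for t
    using LIMSEQ_le_const[OF lim[OF that]] F that by blast
  have S_lim: "(\<lambda>n. S (F n) t) \<longlonglongrightarrow> S f t" if "t \<in> {0..1}" for t
    unfolding S_def by (intro tendsto_intros lim that)
  have conv: "S f integrable_on {0..t}" "(\<lambda>n. integral {0..t} (S (F n))) \<longlonglongrightarrow> integral {0..t} (S f)"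
    if t: "t \<in> {0..1}" for t
  proof -
    have le: "norm (S (F k) x) \<le> B" if "x \<in> {0..t}" for k x
      using S_le[of x "F k"] S_ge[of x "F k"] F[of k] that t by auto
    have *: "(\<lambda>_. B) integrable_on {0..t}" by auto
    have **: "\<And>x. x \<in> {0..t} \<Longrightarrow> (\<lambda>k. S (F k) x) \<longlonglongrightarrow> S f x" using S_lim t by auto
    show "S f integrable_on {0..t}" "(\<lambda>n. integral {0..t} (S (F n))) \<longlonglongrightarrow> integral {0..t} (S f)"
      using dominated_convergence[OF S_int * le **] F t by blast+
  qed
  have f_T: "f t = T f t" if t: "t \<in> {0..1}" for t
  proof -
    have "(\<lambda>n. F (Suc n) t) \<longlonglongrightarrow> T f t" unfolding FS T_def using conv(2)[OF t] by simp
    then show ?thesis using LIMSEQ_unique LIMSEQ_Suc[OF lim[OF t]] by blast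
  qed
  have "continuous_on {0..1} (T f)"
    unfolding T_def by (rule indefinite_integral_continuous_1) (use conv(1)[of 1] in auto)
  then have "continuous_on {0..1} f" by (rule continuous_on_eq) (use f_T in auto)
  then have S_f: "continuous_on {0..1} (S f)" by (rule S_cont)
  have "(f has_real_derivative sqrt (2 * (V t + lam * f t))) (at t within {0..1})" if t: "t \<in> {0..1}" for t
  proof -
    have "(T f has_real_derivative S f t) (at t within {0..1})"
      unfolding T_def by (rule integral_has_real_derivative[OF S_f t])
    then have "(f has_real_derivative S f t) (at t within {0..1})"
      by (rule has_field_derivative_transform_within[OF _ zero_less_one t]) (use f_T in auto)
    then show ?thesis by (simp add: S_def)
  qed
  moreover have "f 0 = 0" using f_T[of 0] by (simp add: T_def)
  ultimately show ?thesis using that f_bounds by blast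
qed

lemma slope_eq_at_touching:
  fixes F \<psi> :: "real \<Rightarrow> real"
  assumes F: "(F has_real_derivative D) (at t)" and \<psi>: "(\<psi> has_real_derivative p) (at t)"
    and ev: "(\<forall>\<^sub>F s in nhds t. F s - \<psi> s \<le> F t - \<psi> t) \<or> (\<forall>\<^sub>F s in nhds t. F t - \<psi> t \<le> F s - \<psi> s)"
  shows "p = D"
proof -
  have D: "((\<lambda>s. F s - \<psi> s) has_real_derivative D - p) (at t)" by (intro DERIV_diff F \<psi>)
  from ev have "D - p = 0"
  proof
    assume "\<forall>\<^sub>F s in nhds t. F s - \<psi> s \<le> F t - \<psi> t"
    then obtain d where d: "d > 0" "\<And>s. dist s t < d \<Longrightarrow> F s - \<psi> s \<le> F t - \<psi> t"
      unfolding eventually_nhds_metric by blast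
    show ?thesis by (rule DERIV_local_max[OF D d(1)]) (use d in \<open>auto simp: dist_real_def abs_minus_commute\<close>)
  next
    assume "\<forall>\<^sub>F s in nhds t. F t - \<psi> t \<le> F s - \<psi> s"
    then obtain d where d: "d > 0" "\<And>s. dist s t < d \<Longrightarrow> F t - \<psi> t \<le> F s - \<psi> s"
      unfolding eventually_nhds_metric by blast
    show ?thesis by (rule DERIV_local_min[OF D d(1)]) (use d in \<open>auto simp: dist_real_def abs_minus_commute\<close>)
  qed
  then show ?thesis by simp
qed

text \<open>If \<open>p > a\<close>, both \<open>f - \<psi>\<close> and \<open>g - \<psi>\<close> have negative derivative at \<open>t\<close>, so their minimum is larger
  just to the left; symmetrically on the right if \<open>p < - a\<close>.\<close>

lemma slope_le_at_concave_kink: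
  fixes f g \<psi> :: "real \<Rightarrow> real"
  assumes f: "(f has_real_derivative a) (at t)" and g: "(g has_real_derivative - a) (at t)"
    and \<psi>: "(\<psi> has_real_derivative p) (at t)" and eq: "f t = g t" and a: "0 \<le> a"
    and ev: "\<forall>\<^sub>F s in nhds t. min (f s) (g s) - \<psi> s \<le> min (f t) (g t) - \<psi> t"
  shows "\<bar>p\<bar> \<le> a"
proof (rule ccontr)
  assume "\<not> ?thesis"
  then have p: "a < \<bar>p\<bar>" by simp
  obtain d where d: "d > 0" "\<And>s. dist s t < d \<Longrightarrow> min (f s) (g s) - \<psi> s \<le> min (f t) (g t) - \<psi> t"
    using ev unfolding eventually_nhds_metric by blast
  have Df: "((\<lambda>s. f s - \<psi> s) has_real_derivative a - p) (at t)" by (intro DERIV_diff f \<psi>)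
  have Dg: "((\<lambda>s. g s - \<psi> s) has_real_derivative - a - p) (at t)" by (intro DERIV_diff g \<psi>)
  show False
  proof (cases "p > 0")
    case True
    have neg: "a - p < 0" "- a - p < 0" using p a True by auto
    obtain df where df: "df > 0" "\<And>h. 0 < h \<Longrightarrow> h < df \<Longrightarrow> f t - \<psi> t < f (t - h) - \<psi> (t - h)"
      using DERIV_neg_dec_left[OF Df] neg by blast
    obtain dg where dg: "dg > 0" "\<And>h. 0 < h \<Longrightarrow> h < dg \<Longrightarrow> g t - \<psi> t < g (t - h) - \<psi> (t - h)"
      using DERIV_neg_dec_left[OF Dg] neg by blast
    define h where "h = min (min df dg) d / 2"
    have h: "0 < h" "h < df" "h < dg" "h < d" using df(1) dg(1) d(1) by (auto simp: h_def)
    then have "min (f (t - h)) (g (t - h)) - \<psi> (t - h) \<le> min (f t) (g t) - \<psi> t"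
      by (intro d(2)) (simp add: dist_real_def)
    then show False using df(2)[OF h(1,2)] dg(2)[OF h(1,3)] eq by (auto simp: min_def split: if_splits)
  next
    case False
    have pos: "0 < a - p" "0 < - a - p" using p a False by auto
    obtain df where df: "df > 0" "\<And>h. 0 < h \<Longrightarrow> h < df \<Longrightarrow> f t - \<psi> t < f (t + h) - \<psi> (t + h)"
      using DERIV_pos_inc_right[OF Df] pos by blast
    obtain dg where dg: "dg > 0" "\<And>h. 0 < h \<Longrightarrow> h < dg \<Longrightarrow> g t - \<psi> t < g (t + h) - \<psi> (t + h)"
      using DERIV_pos_inc_right[OF Dg] pos by blast
    define h where "h = min (min df dg) d / 2"
    have h: "0 < h" "h < df" "h < dg" "h < d" using df(1) dg(1) d(1) by (auto simp: h_def)
    then have "min (f (t + h)) (g (t + h)) - \<psi> (t + h) \<le> min (f t) (g t) - \<psi> t"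
      by (intro d(2)) (simp add: dist_real_def)
    then show False using df(2)[OF h(1,2)] dg(2)[OF h(1,3)] eq by (auto simp: min_def split: if_splits)
  qed
qed

text \<open>The minimum of the increasing branch \<open>f\<close> from 0 and the decreasing branch \<open>G\<close> into 1. It is a
  classical solution where \<open>f \<noteq> G\<close>, has a concave kink where \<open>f = G\<close>, and at the integers it is flat
  with zero energy.\<close>

lemma (in potential_well) solution_exists:
  assumes kappa: "0 < kappa" and lam: "0 < lam"
  obtains w where "continuous_on UNIV w" "\<And>t n. w (t + of_int n) = w t"
    "\<And>t p \<psi>. \<lbrakk>t \<in> {0..<1}; (\<psi> has_real_derivative p) (at t); \<forall>\<^sub>F s in nhds t. w s - \<psi> s \<le> w t - \<psi> t\<rbrakk>
      \<Longrightarrow> p\<^sup>2 / 2 \<le> V t + lam * w t"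
    "\<And>t p \<psi>. \<lbrakk>t \<in> {0..<1}; (\<psi> has_real_derivative p) (at t); \<forall>\<^sub>F s in nhds t. w t - \<psi> t \<le> w s - \<psi> s\<rbrakk>
      \<Longrightarrow> V t + lam * w t \<le> p\<^sup>2 / 2"
proof -
  have V: "continuous_on A V" for A
    using V_deriv DERIV_isCont continuous_at_imp_continuous_on by blast
  have V': "continuous_on {0..1} (\<lambda>t. V (1 - t))"
    by (rule continuous_on_compose2[OF V[of UNIV]]) (auto intro!: continuous_intros)
  obtain f where f: "f 0 = 0" "\<And>t. t \<in> {0..1} \<Longrightarrow> 0 \<le> f t"
    "\<And>t. t \<in> {0..1} \<Longrightarrow> (f has_real_derivative sqrt (2 * (V t + lam * f t))) (at t within {0..1})"
    using increasing_branch_exists[OF V, of lam] V_nonneg lam by auto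
  obtain g where g: "g 0 = 0" "\<And>t. t \<in> {0..1} \<Longrightarrow> 0 \<le> g t"
    "\<And>t. t \<in> {0..1} \<Longrightarrow> (g has_real_derivative sqrt (2 * (V (1 - t) + lam * g t))) (at t within {0..1})"
    using increasing_branch_exists[OF V', of lam] V_nonneg lam by auto
  define G where "G = (\<lambda>t. g (1 - t))"
  define w where "w = (\<lambda>t. min (f (frac t)) (G (frac t)))"
  have per: "w (t + of_int n) = w t" for t n by (simp add: w_def)
  have w01: "w t = min (f t) (G t)" if "t \<in> {0..<1}" for t
    using that frac_eq[of t] by (simp add: w_def)
  have nonneg: "0 \<le> w t" for t
    using f(2)[of "frac t"] g(2)[of "1 - frac t"] frac_ge_0[of t] frac_lt_1[of t] by (auto simp: w_def G_def)
  have w0: "w 0 = 0" using w01[of 0] f(1) g(2)[of 1] by (simp add: G_def)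
  have Df: "(f has_real_derivative sqrt (2 * (V t + lam * f t))) (at t)" if "0 < t" "t < 1" for t
    using f(3)[of t] that at_within_Icc_at[of 0 t 1] by auto
  have DG: "(G has_real_derivative - sqrt (2 * (V t + lam * G t))) (at t)" if "0 < t" "t < 1" for t
  proof -
    have "(g has_real_derivative sqrt (2 * (V t + lam * G t))) (at (1 - t))"
      using g(3)[of "1 - t"] that at_within_Icc_at[of 0 "1 - t" 1] by (auto simp: G_def)
    then have "((\<lambda>t. g (1 - t)) has_real_derivative sqrt (2 * (V t + lam * G t)) * (0 - 1)) (at t)"
      by (rule DERIV_chain2) (auto intro!: derivative_eq_intros)
    then show ?thesis by (simp add: G_def)
  qed
  have flat: "\<exists>d>0. \<forall>t. 0 \<le> t \<and> t < d \<longrightarrow> h t \<le> e * t"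
    if h: "(h has_real_derivative 0) (at 0 within {0..1})" "h 0 = 0" and e: "e > 0" for h :: "real \<Rightarrow> real" and e
  proof -
    have "\<exists>d>0. \<forall>y\<in>{0..1}. norm (y - 0) < d \<longrightarrow> norm (h y - h 0 - 0 * (y - 0)) \<le> e * norm (y - 0)"
      using h(1) e unfolding has_field_derivative_def has_derivative_within_alt by blast
    then obtain d where d: "d > 0" "\<And>y. y \<in> {0..1} \<Longrightarrow> \<bar>y\<bar> < d \<Longrightarrow> \<bar>h y\<bar> \<le> e * \<bar>y\<bar>"
      using h(2) by auto
    have "h t \<le> e * t" if "0 \<le> t" "t < min d 1" for t using d(2)[of t] that by auto
    then show ?thesis using d(1) by (intro exI[of _ "min d 1"]) auto
  qed
  have "V 1 = 0" using V_per[of 0 1] V_zero by simp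
  then have D0: "(f has_real_derivative 0) (at 0 within {0..1})" "(g has_real_derivative 0) (at 0 within {0..1})"
    using f(3)[of 0] g(3)[of 0] V_zero f(1) g(1) by auto
  have Dw0: "(w has_real_derivative 0) (at 0)"
    unfolding has_field_derivative_def has_derivative_within_alt
  proof (intro conjI allI impI)
    show "bounded_linear ((*) (0::real))" by (rule bounded_linear_mult_right)
    fix e :: real assume e: "e > 0"
    obtain d1 where d1: "d1 > 0" "\<And>t. 0 \<le> t \<Longrightarrow> t < d1 \<Longrightarrow> f t \<le> e * t"
      using flat[OF D0(1) f(1) e] by blast
    obtain d2 where d2: "d2 > 0" "\<And>t. 0 \<le> t \<Longrightarrow> t < d2 \<Longrightarrow> g t \<le> e * t"
      using flat[OF D0(2) g(1) e] by blast
    have "w y \<le> e * \<bar>y\<bar>" if "\<bar>y\<bar> < min (min d1 d2) 1" for y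
    proof (cases "y \<ge> 0")
      case True then show ?thesis using w01[of y] d1(2)[of y] that by auto
    next
      case False
      have "w y = w (y + 1)" using per[of y 1] by simp
      also have "\<dots> \<le> g (- y)" using w01[of "y + 1"] that False by (auto simp: G_def)
      also have "\<dots> \<le> e * (- y)" using d2(2)[of "- y"] that False by auto
      finally show ?thesis using False by simp
    qed
    then show "\<exists>d>0. \<forall>y\<in>UNIV. norm (y - 0) < d \<longrightarrow> norm (w y - w 0 - 0 * (y - 0)) \<le> e * norm (y - 0)"
      using d1(1) d2(1) nonneg w0 by (intro exI[of _ "min (min d1 d2) 1"]) auto
  qed
  have near: "\<forall>\<^sub>F s in nhds t. w s = min (f s) (G s)" if "0 < t" "t < 1" for t
  proof -
    have "\<forall>\<^sub>F s in nhds t. s \<in> {0<..<1}" by (rule eventually_nhds_in_open) (use that in auto)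
    then show ?thesis by eventually_elim (simp add: w01)
  qed
  have cont01: "isCont w t" if t: "t \<in> {0..<1}" for t
  proof (cases "t = 0")
    case True then show ?thesis using DERIV_isCont[OF Dw0] by simp
  next
    case False
    then have t: "0 < t" "t < 1" using t by auto
    have "isCont (\<lambda>s. min (f s) (G s)) t"
      using DERIV_isCont[OF Df[OF t]] DERIV_isCont[OF DG[OF t]] by (intro continuous_intros)
    then show ?thesis using isCont_cong[OF near[OF t]] by blast
  qed
  have "isCont w t" for t
  proof -
    have "isCont (\<lambda>s. w (s - of_int \<lfloor>t\<rfloor>)) t"
      by (rule isCont_o2[where g = w]) (use cont01[of "frac t"] in \<open>auto simp: frac_def[symmetric] frac_lt_1\<close>)
    moreover have "w (s - of_int \<lfloor>t\<rfloor>) = w s" for s using per[of "s - of_int \<lfloor>t\<rfloor>" "\<lfloor>t\<rfloor>"] by simp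
    ultimately show ?thesis by simp
  qed
  then have cont: "continuous_on UNIV w" by (simp add: continuous_on_eq_continuous_at)
  have V_pos: "0 < V t" if "0 < t" "t < 1" for t
  proof -
    have "0 < (kappa * (t * (1 - t)))\<^sup>2" using kappa that by simp
    moreover have "(kappa * (t * (1 - t)))\<^sup>2 \<le> 2 * V t" by (rule V_lower) (use that in auto)
    ultimately show ?thesis by linarith
  qed
  have smooth: "p\<^sup>2 / 2 = V t + lam * w t"
    if t: "0 < t" "t < 1" and ne: "f t \<noteq> G t" and \<psi>: "(\<psi> has_real_derivative p) (at t)"
      and ev: "(\<forall>\<^sub>F s in nhds t. w s - \<psi> s \<le> w t - \<psi> t) \<or> (\<forall>\<^sub>F s in nhds t. w t - \<psi> t \<le> w s - \<psi> s)"
    for t p \<psi>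
  proof -
    have E: "0 \<le> V t + lam * w t" using V_nonneg nonneg lam by simp
    have lt: "\<forall>\<^sub>F s in nhds t. a s < b s" if "isCont a t" "isCont b t" "a t < b t" for a b :: "real \<Rightarrow> real"
    proof -
      have "(a \<longlongrightarrow> a t) (nhds t)" "(b \<longlongrightarrow> b t) (nhds t)"
        using that(1,2) by (simp_all add: isCont_def tendsto_nhds_iff)
      then have "((\<lambda>s. b s - a s) \<longlongrightarrow> b t - a t) (nhds t)" by (intro tendsto_diff)
      then have "\<forall>\<^sub>F s in nhds t. 0 < b s - a s" by (rule order_tendstoD(1)) (use that(3) in simp)
      then show ?thesis by eventually_elim simp
    qed
    show ?thesis
    proof (cases "f t < G t")
      case True
      have "\<forall>\<^sub>F s in nhds t. f s < G s"
        by (rule lt[OF DERIV_isCont[OF Df[OF t]] DERIV_isCont[OF DG[OF t]] True])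
      then have "\<forall>\<^sub>F s in nhds t. w s = f s" using near[OF t] by eventually_elim auto
      then have "(w has_real_derivative sqrt (2 * (V t + lam * w t))) (at t)"
        using Df[OF t] w01[of t] t True by (subst DERIV_cong_ev[OF refl _ refl]) auto
      then have "p = sqrt (2 * (V t + lam * w t))" by (rule slope_eq_at_touching[OF _ \<psi> ev])
      then show ?thesis using E by simp
    next
      case False
      with ne have "G t < f t" by simp
      then have "\<forall>\<^sub>F s in nhds t. G s < f s"
        by (rule lt[OF DERIV_isCont[OF DG[OF t]] DERIV_isCont[OF Df[OF t]]])
      then have "\<forall>\<^sub>F s in nhds t. w s = G s" using near[OF t] by eventually_elim auto
      then have "(w has_real_derivative - sqrt (2 * (V t + lam * w t))) (at t)"
        using DG[OF t] w01[of t] t False by (subst DERIV_cong_ev[OF refl _ refl]) auto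
      then have "p = - sqrt (2 * (V t + lam * w t))" by (rule slope_eq_at_touching[OF _ \<psi> ev])
      then show ?thesis using E by simp
    qed
  qed
  have kink: "w t = f t" "0 < V t + lam * f t"
      "(f has_real_derivative sqrt (2 * (V t + lam * f t))) (at t)"
      "(G has_real_derivative - sqrt (2 * (V t + lam * f t))) (at t)"
    if "0 < t" "t < 1" "f t = G t" for t
    using w01[of t] V_pos[of t] f(2)[of t] lam Df[of t] DG[of t] that by (auto intro: add_pos_nonneg)
  show ?thesis
  proof (rule that[OF cont per])
    fix t p \<psi>
    assume t: "t \<in> {0..<1}" and \<psi>: "(\<psi> has_real_derivative p) (at t)"
      and ev: "\<forall>\<^sub>F s in nhds t. w s - \<psi> s \<le> w t - \<psi> t"
    consider "t = 0" | "0 < t" "t < 1" "f t \<noteq> G t" | "0 < t" "t < 1" "f t = G t" using t by (auto simp: less_le)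
    then show "p\<^sup>2 / 2 \<le> V t + lam * w t"
    proof cases
      case 1
      then show ?thesis using slope_eq_at_touching[OF Dw0, of \<psi> p] \<psi> ev V_zero w0 by simp
    next
      case 2
      show ?thesis using smooth[OF 2 \<psi>] ev by simp
    next
      case 3
      have "\<forall>\<^sub>F s in nhds t. min (f s) (G s) - \<psi> s \<le> min (f t) (G t) - \<psi> t"
        using ev near[OF 3(1,2)] by eventually_elim (use w01[OF t] in simp)
      then have "\<bar>p\<bar> \<le> sqrt (2 * (V t + lam * f t))"
        by (rule slope_le_at_concave_kink[OF kink(3,4)[OF 3] \<psi> 3(3), rotated]) (use kink(2)[OF 3] in simp)
      then have "\<bar>p\<bar>\<^sup>2 \<le> (sqrt (2 * (V t + lam * f t)))\<^sup>2" by (intro power_mono) auto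
      then show ?thesis using kink(1,2)[OF 3] by simp
    qed
  next
    fix t p \<psi>
    assume t: "t \<in> {0..<1}" and \<psi>: "(\<psi> has_real_derivative p) (at t)"
      and ev: "\<forall>\<^sub>F s in nhds t. w t - \<psi> t \<le> w s - \<psi> s"
    consider "t = 0" | "0 < t" "t < 1" "f t \<noteq> G t" | "0 < t" "t < 1" "f t = G t" using t by (auto simp: less_le)
    then show "V t + lam * w t \<le> p\<^sup>2 / 2"
    proof cases
      case 1
      then show ?thesis using V_zero w0 by simp
    next
      case 2
      show ?thesis using smooth[OF 2 \<psi>] ev by simp
    next
      case 3
      \<comment> \<open>a function below both branches would have to be tangent to both\<close>
      have "\<forall>\<^sub>F s in nhds t. f t - \<psi> t \<le> f s - \<psi> s" "\<forall>\<^sub>F s in nhds t. G t - \<psi> t \<le> G s - \<psi> s"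
        using ev near[OF 3(1,2)] by (eventually_elim, use kink(1)[OF 3] 3(3) in \<open>simp add: min_def split: if_splits\<close>)+
      then have "p = sqrt (2 * (V t + lam * f t))" "p = - sqrt (2 * (V t + lam * f t))"
        using slope_eq_at_touching[OF _ \<psi>] kink(3,4)[OF 3] by blast+
      then show ?thesis using kink(2)[OF 3] by simp
    qed
  qed
qed

section \<open>From the circle to the line\<close>

lemma proj_eq_iff: "proj s = proj t \<longleftrightarrow> s - t \<in> \<int>"
  using circle.abs_eq_iff by (simp add: int_cong_def)

lemma proj_add_int [simp]: "proj (t + of_int n) = proj t"
  by (simp add: proj_eq_iff)

lemma proj_rep [simp]: "proj (rep_circle x) = x"
  by (rule Quotient3_abs_rep[OF Quotient3_circle])

lemma open_circle_iff: "open S \<longleftrightarrow> open (proj -` S)"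
  by (rule open_circle_def)

lemma continuous_on_circle_iff:
  "continuous_on UNIV f \<longleftrightarrow> continuous_on UNIV (\<lambda>t. f (proj t))" for f :: "circle \<Rightarrow> real"
  by (simp add: continuous_on_open_vimage open_circle_iff vimage_def)

lemma eventually_nhds_proj_iff:
  "(\<forall>\<^sub>F y in nhds (proj (t + a)). P y) \<longleftrightarrow> (\<forall>\<^sub>F s in nhds t. P (proj (s + a)))"
proof
  assume "\<forall>\<^sub>F y in nhds (proj (t + a)). P y"
  then obtain S where S: "open S" "proj (t + a) \<in> S" "\<And>y. y \<in> S \<Longrightarrow> P y"
    unfolding eventually_nhds by blast
  have "open ((\<lambda>s. s + a) -` (proj -` S))"
    by (rule open_vimage[OF open_circle_iff[THEN iffD1, OF S(1)]]) (intro continuous_intros)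
  then show "\<forall>\<^sub>F s in nhds t. P (proj (s + a))"
    unfolding eventually_nhds using S by (intro exI[of _ "(\<lambda>s. s + a) -` (proj -` S)"]) auto
next
  assume "\<forall>\<^sub>F s in nhds t. P (proj (s + a))"
  then obtain S where S: "open S" "t \<in> S" "\<And>s. s \<in> S \<Longrightarrow> P (proj (s + a))"
    unfolding eventually_nhds by blast
  have "proj -` ((\<lambda>s. proj (s + a)) ` S) = (\<Union>n::int. (\<lambda>r. r + (of_int n - a)) -` S)" (is "?L = ?R")
  proof (intro set_eqI iffI)
    fix r assume "r \<in> ?L"
    then obtain s where s: "s \<in> S" "proj r = proj (s + a)" by auto
    then obtain n where "s + a - r = of_int n" unfolding proj_eq_iff
      by (metis Ints_cases Ints_minus minus_diff_eq)
    then have "r + (of_int n - a) = s" by simp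
    then show "r \<in> ?R" using s(1) by auto
  next
    fix r assume "r \<in> ?R"
    then obtain n :: int where n: "r + (of_int n - a) \<in> S" by auto
    have "proj r = proj (r + (of_int n - a) + a)" by simp
    then show "r \<in> ?L" using n by blast
  qed
  moreover have "open ?R" by (intro open_UN ballI open_vimage S(1)) (auto intro!: continuous_intros)
  ultimately have "open ((\<lambda>s. proj (s + a)) ` S)" by (simp add: open_circle_iff)
  then show "\<forall>\<^sub>F y in nhds (proj (t + a)). P y"
    unfolding eventually_nhds using S by (intro exI[of _ "(\<lambda>s. proj (s + a)) ` S"]) auto
qed

text \<open>A 1-periodic function with slope \<open>p\<close> at 0 that dominates \<open>p h + B h\<^sup>2\<close> near 0 once \<open>A\<close> is large.\<close>

definition trig_test :: "real \<Rightarrow> real \<Rightarrow> real \<Rightarrow> real" where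
  "trig_test p A h = p * sin (2 * pi * h) / (2 * pi) + A * (sin (pi * h))\<^sup>2"

text \<open>The first summand differs from \<open>p h\<close> by at most \<open>pi \<bar>p\<bar> h\<^sup>2\<close>, and \<open>(sin (pi h))\<^sup>2 \<ge> h\<^sup>2\<close>; both follow
  from \<open>\<bar>sin x - x\<bar> \<le> x\<^sup>2 / 2\<close>.\<close>

lemma trig_test_ge:
  assumes h: "\<bar>h\<bar> \<le> 1 / 4" and A: "\<bar>B\<bar> + pi * \<bar>p\<bar> \<le> A"
  shows "p * h + B * h\<^sup>2 \<le> trig_test p A h"
proof -
  have sin: "\<bar>sin x - x\<bar> \<le> x\<^sup>2 / 2" for x :: real
    using Maclaurin_sin_bound[of x 2] by (simp add: numeral_2_eq_2 sin_coeff_def power2_eq_square divide_simps)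
  have "\<bar>p * sin (2 * pi * h) / (2 * pi) - p * h\<bar> = \<bar>p\<bar> * \<bar>sin (2 * pi * h) - 2 * pi * h\<bar> / (2 * pi)"
  proof -
    have "p * sin (2 * pi * h) / (2 * pi) - p * h = p * (sin (2 * pi * h) - 2 * pi * h) / (2 * pi)"
      by (simp add: field_simps)
    then show ?thesis by (simp add: abs_mult)
  qed
  also have "\<dots> \<le> \<bar>p\<bar> * ((2 * pi * h)\<^sup>2 / 2) / (2 * pi)"
    using sin[of "2 * pi * h"] by (intro divide_right_mono mult_left_mono) auto
  also have "\<dots> = pi * \<bar>p\<bar> * h\<^sup>2" by (simp add: power2_eq_square)
  finally have 1: "p * h - pi * \<bar>p\<bar> * h\<^sup>2 \<le> p * sin (2 * pi * h) / (2 * pi)" by linarith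
  define y where "y = pi * \<bar>h\<bar>"
  have "pi * \<bar>h\<bar> \<le> 4 * (1 / 4)" using h pi_less_4 by (intro mult_mono) auto
  then have y: "0 \<le> y" "y \<le> 1" by (auto simp: y_def)
  have "2 * \<bar>h\<bar> \<le> y" unfolding y_def using pi_ge_two by (intro mult_right_mono) auto
  moreover have "y\<^sup>2 \<le> y" using y by (simp add: power2_eq_square mult_left_le)
  ultimately have "\<bar>h\<bar> \<le> sin y" using sin[of y] by linarith
  then have "\<bar>h\<bar>\<^sup>2 \<le> (sin y)\<^sup>2" by (intro power_mono) auto
  moreover have "(sin y)\<^sup>2 = (sin (pi * h))\<^sup>2" by (cases "h \<ge> 0") (auto simp: y_def)
  ultimately have 2: "h\<^sup>2 \<le> (sin (pi * h))\<^sup>2" by simp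
  have "0 \<le> pi * \<bar>p\<bar>" by simp
  then have "A \<ge> 0" using A by linarith
  have "(B + pi * \<bar>p\<bar>) * h\<^sup>2 \<le> A * h\<^sup>2" using A by (intro mult_right_mono) auto
  also have "\<dots> \<le> A * (sin (pi * h))\<^sup>2" using 2 \<open>A \<ge> 0\<close> by (rule mult_left_mono)
  finally show ?thesis using 1 by (simp add: trig_test_def algebra_simps)
qed

lemma trig_test_periodic: "trig_test p A (h + of_int n) = trig_test p A h"
proof -
  have "sin (2 * pi * (h + of_int n)) = sin (2 * pi * h)"
    using sin_int_2pin[of n] cos_int_2pin[of n] by (simp add: distrib_left sin_add mult_ac)
  moreover have "sin (pi * (h + of_int n)) = sin (pi * h) * cos (pi * of_int n)"
    using sin_int_times_real by (simp add: distrib_left sin_add)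
  moreover have "(cos (pi * of_int n))\<^sup>2 = 1"
    using sin_cos_squared_add[of "pi * of_int n"] by (simp add: sin_zero_iff_int2)
  ultimately show ?thesis by (simp add: trig_test_def power_mult_distrib)
qed

lemma circle_test_function:
  obtains \<phi> where "circle_C 1 \<phi>" "circle_deriv \<phi> (proj s) = p"
    "\<And>r. \<phi> (proj r) = trig_test p A (r - s)"
proof -
  define \<phi> where "\<phi> = (\<lambda>x. trig_test p A (rep_circle x - s))"
  have val: "\<phi> (proj r) = trig_test p A (r - s)" for r
  proof -
    have "rep_circle (proj r) - r \<in> \<int>" using proj_eq_iff[of "rep_circle (proj r)" r] by simp
    then obtain n where "rep_circle (proj r) - r = of_int n" by (auto elim: Ints_cases)
    then have "rep_circle (proj r) - s = (r - s) + of_int n" by simp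
    then show ?thesis unfolding \<phi>_def by (metis trig_test_periodic)
  qed
  have D: "((\<lambda>r. \<phi> (proj r)) has_real_derivative
      p * cos (2 * pi * (r - s)) + A * (2 * pi * sin (pi * (r - s)) * cos (pi * (r - s)))) (at r)" for r
    unfolding val trig_test_def
    by (auto intro!: derivative_eq_intros simp: field_simps)
  have dval: "circle_deriv \<phi> (proj r) =
      p * cos (2 * pi * (r - s)) + A * (2 * pi * sin (pi * (r - s)) * cos (pi * (r - s)))" for r
    unfolding circle_deriv_proj using D by (rule DERIV_imp_deriv)
  have "continuous_on UNIV (circle_deriv \<phi>)"
    unfolding continuous_on_circle_iff dval by (intro continuous_intros)
  moreover have "(\<lambda>r. \<phi> (proj r)) field_differentiable (at t)" for t
    using D field_differentiable_def by blast
  ultimately have "circle_C 1 \<phi>" by (simp add: circle_C_def)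
  moreover have "circle_deriv \<phi> (proj s) = p" by (simp add: dval)
  ultimately show ?thesis using that val by blast
qed

text \<open>With \<open>\<sigma> = 1\<close> the test function touches \<open>u\<close> from above. With \<open>\<sigma> = - 1\<close> its negative does, so for
  \<open>- u\<close> in place of \<open>u\<close> it touches the solution from below.\<close>

lemma superjet_test_function:
  assumes "superjet (\<lambda>t. u (proj (t + a))) t p" and "\<sigma> = 1 \<or> \<sigma> = - 1"
  obtains \<phi> where "circle_C 1 \<phi>" "circle_deriv \<phi> (proj (t + a)) = \<sigma> * p"
    "\<forall>\<^sub>F y in nhds (proj (t + a)). u y - u (proj (t + a)) \<le> \<sigma> * (\<phi> y - \<phi> (proj (t + a)))"
proof -
  obtain B where B: "\<forall>\<^sub>F s in nhds t. u (proj (s + a)) \<le> u (proj (t + a)) + p * (s - t) + B * (s - t)\<^sup>2"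
    using assms unfolding superjet_def by blast
  define A where "A = \<bar>B\<bar> + pi * \<bar>p\<bar>"
  obtain \<phi> where \<phi>: "circle_C 1 \<phi>" "circle_deriv \<phi> (proj (t + a)) = \<sigma> * p"
    "\<And>r. \<phi> (proj r) = trig_test (\<sigma> * p) (\<sigma> * A) (r - (t + a))"
    using circle_test_function[of "t + a" "\<sigma> * p" "\<sigma> * A"] by blast
  have \<sigma>: "\<sigma> * (\<phi> (proj (s + a)) - \<phi> (proj (t + a))) = trig_test p A (s - t)" for s
    using assms(2) by (auto simp: \<phi>(3) trig_test_def algebra_simps)
  have "\<forall>\<^sub>F s in nhds t. dist s t < 1 / 4" unfolding eventually_nhds_metric by (intro exI[of _ "1/4"]) auto
  with B have "\<forall>\<^sub>F s in nhds t. u (proj (s + a)) - u (proj (t + a)) \<le> \<sigma> * (\<phi> (proj (s + a)) - \<phi> (proj (t + a)))"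
  proof eventually_elim
    case (elim s)
    have "p * (s - t) + B * (s - t)\<^sup>2 \<le> trig_test p A (s - t)"
      by (rule trig_test_ge) (use elim(2) in \<open>auto simp: dist_real_def A_def\<close>)
    then show ?case using elim(1) \<sigma> by simp
  qed
  then show ?thesis using that[OF \<phi>(1,2)] eventually_nhds_proj_iff by simp
qed

lemma jet_solution_if_viscosity_solution:
  assumes sol: "viscosity_solution (\<lambda>x r p. - lam * r + 1/2 * \<bar>p\<bar>\<^sup>2 + U x) c u"
    and U: "continuous_on UNIV U"
  shows "jet_solution lam (\<lambda>t. c - U (proj (t + a))) (\<lambda>t. u (proj (t + a)))"
  unfolding jet_solution_def
proof (intro conjI allI impI)
  have shift: "continuous_on UNIV (\<lambda>t. f (proj (t + a)))" if "continuous_on UNIV f" for f :: "circle \<Rightarrow> real"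
    using that unfolding continuous_on_circle_iff
    by (rule continuous_on_compose2) (auto intro!: continuous_intros)
  have u: "continuous_on UNIV u"
    using sol by (simp add: viscosity_solution_def viscosity_subsolution_def)
  show "continuous_on UNIV (\<lambda>t. c - U (proj (t + a)))" "continuous_on UNIV (\<lambda>t. u (proj (t + a)))"
    by (intro continuous_intros shift U u)+
next
  fix t p assume "superjet (\<lambda>t. u (proj (t + a))) t p"
  then obtain \<phi> where \<phi>: "circle_C 1 \<phi>" "circle_deriv \<phi> (proj (t + a)) = p"
    "\<forall>\<^sub>F y in nhds (proj (t + a)). u y - u (proj (t + a)) \<le> 1 * (\<phi> y - \<phi> (proj (t + a)))"
    using superjet_test_function[of u a t p 1] by auto
  have "\<forall>\<^sub>F y in nhds (proj (t + a)). u y - \<phi> y \<le> u (proj (t + a)) - \<phi> (proj (t + a))"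
    using \<phi>(3) by eventually_elim simp
  then have "- lam * u (proj (t + a)) + 1/2 * \<bar>circle_deriv \<phi> (proj (t + a))\<bar>\<^sup>2 + U (proj (t + a)) \<le> c"
    using sol \<phi>(1) unfolding viscosity_solution_def viscosity_subsolution_def by blast
  then show "p\<^sup>2 / 2 \<le> c - U (proj (t + a)) + lam * u (proj (t + a))" unfolding \<phi>(2) by simp
next
  fix t p assume "superjet (\<lambda>t. - u (proj (t + a))) t p"
  then obtain \<phi> where \<phi>: "circle_C 1 \<phi>" "circle_deriv \<phi> (proj (t + a)) = - p"
    "\<forall>\<^sub>F y in nhds (proj (t + a)). - u y - - u (proj (t + a)) \<le> - 1 * (\<phi> y - \<phi> (proj (t + a)))"
    using superjet_test_function[of "\<lambda>x. - u x" a t p "- 1"] by auto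
  have "\<forall>\<^sub>F y in nhds (proj (t + a)). u y - \<phi> y \<ge> u (proj (t + a)) - \<phi> (proj (t + a))"
    using \<phi>(3) by eventually_elim simp
  then have "- lam * u (proj (t + a)) + 1/2 * \<bar>circle_deriv \<phi> (proj (t + a))\<bar>\<^sup>2 + U (proj (t + a)) \<ge> c"
    using sol \<phi>(1) unfolding viscosity_solution_def viscosity_supersolution_def by blast
  then show "c - U (proj (t + a)) + lam * u (proj (t + a)) \<le> p\<^sup>2 / 2" unfolding \<phi>(2) by simp
qed

lemma proj_surj: obtains t where "t \<in> {0..<1}" "x = proj (t + a)"
proof
  show "frac (rep_circle x - a) \<in> {0..<1}" by (simp add: frac_lt_1)
  have "frac (rep_circle x - a) + a = rep_circle x + of_int (- \<lfloor>rep_circle x - a\<rfloor>)"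
    by (simp add: frac_def)
  then have "proj (frac (rep_circle x - a) + a) = proj (rep_circle x)" by (simp only: proj_add_int)
  then show "x = proj (frac (rep_circle x - a) + a)" by simp
qed

text \<open>Of a \<open>C\<^sup>1\<close> test function the lifted conditions see only that it is differentiable at the touching
  point, and by periodicity one period of touching points suffices.\<close>

lemma viscosity_solution_of_lift:
  assumes w: "continuous_on UNIV w" "\<And>t n. w (t + of_int n) = w t"
    and sub: "\<And>t p \<psi>. \<lbrakk>t \<in> {0..<1}; (\<psi> has_real_derivative p) (at t);
        \<forall>\<^sub>F s in nhds t. w s - \<psi> s \<le> w t - \<psi> t\<rbrakk> \<Longrightarrow> p\<^sup>2 / 2 \<le> c - U (proj (t + a)) + lam * w t"
    and super: "\<And>t p \<psi>. \<lbrakk>t \<in> {0..<1}; (\<psi> has_real_derivative p) (at t);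
        \<forall>\<^sub>F s in nhds t. w t - \<psi> t \<le> w s - \<psi> s\<rbrakk> \<Longrightarrow> c - U (proj (t + a)) + lam * w t \<le> p\<^sup>2 / 2"
  shows "viscosity_solution (\<lambda>x r p. - lam * r + 1/2 * \<bar>p\<bar>\<^sup>2 + U x) c (\<lambda>x. w (rep_circle x - a))"
proof -
  let ?u = "\<lambda>x. w (rep_circle x - a)"
  have u: "?u (proj t) = w (t - a)" for t
  proof -
    have "rep_circle (proj t) - t \<in> \<int>" using proj_eq_iff[of "rep_circle (proj t)" t] by simp
    then obtain n where "rep_circle (proj t) - t = of_int n" by (auto elim: Ints_cases)
    then have "rep_circle (proj t) - a = (t - a) + of_int n" by simp
    then show ?thesis by (metis w(2))
  qed
  have cont: "continuous_on UNIV ?u"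
    unfolding continuous_on_circle_iff u
    by (rule continuous_on_compose2[OF w(1)]) (auto intro!: continuous_intros)
  have D: "((\<lambda>s. \<phi> (proj (s + a))) has_real_derivative circle_deriv \<phi> (proj (t + a))) (at t)"
    if "circle_C 1 \<phi>" for \<phi> t
  proof -
    have "(\<lambda>s. \<phi> (proj s)) field_differentiable (at (t + a))" using that by (simp add: circle_C_def)
    then have "((\<lambda>s. \<phi> (proj s)) has_real_derivative circle_deriv \<phi> (proj (t + a))) (at (t + a))"
      unfolding circle_deriv_proj DERIV_deriv_iff_field_differentiable .
    then show ?thesis by (simp add: DERIV_shift)
  qed
  have "- lam * ?u x + 1/2 * \<bar>circle_deriv \<phi> x\<bar>\<^sup>2 + U x \<le> c"
    if \<phi>: "circle_C 1 \<phi>" and ev: "\<forall>\<^sub>F y in nhds x. ?u y - \<phi> y \<le> ?u x - \<phi> x" for \<phi> x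
  proof -
    obtain t where t: "t \<in> {0..<1}" "x = proj (t + a)" by (rule proj_surj)
    have "\<forall>\<^sub>F s in nhds t. w s - \<phi> (proj (s + a)) \<le> w t - \<phi> (proj (t + a))"
      using ev unfolding t(2) eventually_nhds_proj_iff u by simp
    from sub[OF t(1) D[OF \<phi>] this] show ?thesis unfolding t(2) u by simp
  qed
  moreover have "- lam * ?u x + 1/2 * \<bar>circle_deriv \<phi> x\<bar>\<^sup>2 + U x \<ge> c"
    if \<phi>: "circle_C 1 \<phi>" and ev: "\<forall>\<^sub>F y in nhds x. ?u x - \<phi> x \<le> ?u y - \<phi> y" for \<phi> x
  proof -
    obtain t where t: "t \<in> {0..<1}" "x = proj (t + a)" by (rule proj_surj)
    have "\<forall>\<^sub>F s in nhds t. w t - \<phi> (proj (t + a)) \<le> w s - \<phi> (proj (s + a))"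
      using ev unfolding t(2) eventually_nhds_proj_iff u by simp
    from super[OF t(1) D[OF \<phi>] this] show ?thesis unfolding t(2) u by simp
  qed
  ultimately show ?thesis
    unfolding viscosity_solution_def viscosity_subsolution_def viscosity_supersolution_def
    using cont by blast
qed

section \<open>The theorem\<close>

theorem mainTheorem3:
  fixes c :: real and U :: "circle \<Rightarrow> real" and x0 :: circle
  assumes "circle_C 3 U"
    and "\<forall>y. y \<noteq> x0 \<longrightarrow> U y < U x0"
    and "U x0 = c"
    and "circle_deriv (circle_deriv U) x0 < 0"
  shows "\<exists>lam0>0. \<forall>lam. 0 < lam \<and> lam < lam0 \<longrightarrow>
    (\<exists>!u. viscosity_solution (\<lambda>x r p. - lam * r + 1/2 * \<bar>p\<bar>\<^sup>2 + U x) c u)"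
proof -
  define a where "a = rep_circle x0"
  have a: "proj a = x0" by (simp add: a_def)
  define V where "V = (\<lambda>t. c - U (proj (t + a)))"
  define V' where "V' = (\<lambda>t. - circle_deriv U (proj (t + a)))"
  have per_proj: "proj (t + of_int n + a) = proj (t + a)" for t n
    by (simp add: proj_eq_iff)
  have diff: "((\<lambda>s. f (proj (s + a))) has_real_derivative circle_deriv f (proj (t + a))) (at t)"
    if "\<And>t. (\<lambda>s. f (proj s)) field_differentiable (at t)" for f t
  proof -
    have "((\<lambda>s. f (proj s)) has_real_derivative circle_deriv f (proj (t + a))) (at (t + a))"
      using that unfolding circle_deriv_proj DERIV_deriv_iff_field_differentiable .
    then show ?thesis by (simp add: DERIV_shift)
  qed
  have C3: "(\<lambda>s. (circle_deriv ^^ i) U (proj s)) field_differentiable (at t)" if "i < 3" for i t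
    using assms(1) that by (simp add: circle_C_def)
  have U0: "(\<lambda>s. U (proj s)) field_differentiable (at t)" for t using C3[of 0] by simp
  have U1: "(\<lambda>s. circle_deriv U (proj s)) field_differentiable (at t)" for t using C3[of 1] by simp
  have U: "continuous_on UNIV U"
    unfolding continuous_on_circle_iff
    using U0 field_differentiable_imp_continuous_at continuous_at_imp_continuous_on by blast
  have DV: "(V has_real_derivative V' t) (at t)" for t
    using DERIV_diff[OF DERIV_const diff[OF U0], of c t] by (simp add: V_def V'_def)
  have DV': "(V' has_real_derivative - circle_deriv (circle_deriv U) x0) (at 0)"
    using DERIV_minus[OF diff[OF U1], of 0] by (simp add: V'_def a)
  have V_per: "V (t + of_int n) = V t" for t n by (simp add: V_def per_proj)
  have V_pos: "0 < V t" if "0 < t" "t < 1" for t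
  proof -
    have "proj (t + a) \<noteq> proj a" using that by (auto simp: proj_eq_iff elim!: Ints_cases)
    then show ?thesis using assms(2,3) a by (simp add: V_def)
  qed
  obtain kappa eta C where well: "kappa > 0" "eta > 0" "potential_well V V' kappa eta C"
    by (rule nondegenerate_min_potential_well[OF V_per DV _ V_pos DV']) (use assms(3,4) a in \<open>auto simp: V_def\<close>)
  interpret potential_well V V' kappa eta C by (rule well)
  define L where "L = sqrt (2 * (3 * C + 2))"
  have "C \<ge> 0" using V_upper[of 0] V_zero by simp
  then have L: "L > 0" by (simp add: L_def)
  define lam0 where "lam0 = min 1 (min (kappa / 2) (eta / L))"
  have "\<exists>!u. viscosity_solution (\<lambda>x r p. - lam * r + 1/2 * \<bar>p\<bar>\<^sup>2 + U x) c u"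
    if lam: "0 < lam" "lam < lam0" for lam
  proof -
    have small: "lam \<le> 1" "lam * L < eta" "lam \<le> kappa / 2"
      using lam(2) L by (auto simp: lam0_def pos_less_divide_eq)
    obtain w where w: "continuous_on UNIV w" "\<And>t n. w (t + of_int n) = w t"
      "\<And>t p \<psi>. \<lbrakk>t \<in> {0..<1}; (\<psi> has_real_derivative p) (at t); \<forall>\<^sub>F s in nhds t. w s - \<psi> s \<le> w t - \<psi> t\<rbrakk>
        \<Longrightarrow> p\<^sup>2 / 2 \<le> V t + lam * w t"
      "\<And>t p \<psi>. \<lbrakk>t \<in> {0..<1}; (\<psi> has_real_derivative p) (at t); \<forall>\<^sub>F s in nhds t. w t - \<psi> t \<le> w s - \<psi> s\<rbrakk>
        \<Longrightarrow> V t + lam * w t \<le> p\<^sup>2 / 2"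
      using solution_exists[OF well(1) lam(1)] by blast
    show ?thesis
    proof (rule ex_ex1I)
      show "\<exists>u. viscosity_solution (\<lambda>x r p. - lam * r + 1/2 * \<bar>p\<bar>\<^sup>2 + U x) c u"
      proof (rule exI, rule viscosity_solution_of_lift[OF w(1,2)])
        fix t p \<psi>
        assume t: "t \<in> {0..<1}" "(\<psi> has_real_derivative p) (at t)"
        show "p\<^sup>2 / 2 \<le> c - U (proj (t + a)) + lam * w t"
          if "\<forall>\<^sub>F s in nhds t. w s - \<psi> s \<le> w t - \<psi> t"
          using w(3)[OF t that] by (simp add: V_def)
        show "c - U (proj (t + a)) + lam * w t \<le> p\<^sup>2 / 2"
          if "\<forall>\<^sub>F s in nhds t. w t - \<psi> t \<le> w s - \<psi> s"
          using w(4)[OF t that] by (simp add: V_def)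
      qed
      fix u v
      assume u: "viscosity_solution (\<lambda>x r p. - lam * r + 1/2 * \<bar>p\<bar>\<^sup>2 + U x) c u"
        and v: "viscosity_solution (\<lambda>x r p. - lam * r + 1/2 * \<bar>p\<bar>\<^sup>2 + U x) c v"
      have jets: "jet_solution lam V (\<lambda>t. u (proj (t + a)))" "jet_solution lam V (\<lambda>t. v (proj (t + a)))"
        unfolding V_def by (rule jet_solution_if_viscosity_solution[OF _ U], fact)+
      show "u = v"
      proof
        fix x
        obtain t where t: "t \<in> {0..<1}" "x = proj (t + a)" by (rule proj_surj)
        have "u (proj (t + a)) = v (proj (t + a))"
          by (rule solution_unique[where u = "\<lambda>t. u (proj (t + a))" and v = "\<lambda>t. v (proj (t + a))",
                OF jets(1) _ jets(2) _ lam(1) small(1) small(2)[unfolded L_def] small(3)])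
            (use t(1) in \<open>simp_all add: per_proj\<close>)
        then show "u x = v x" by (simp add: t(2))
      qed
    qed
  qed
  moreover have "lam0 > 0" using well L by (simp add: lam0_def)
  ultimately show ?thesis by blast
qed

end
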